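(* Let $n\ge 3$ and let $\{f_{a,b}(x;\theta)\}$ be a one-parameter family of location-scale densities on $\mathbb{R}$ as described in the context, with $f(x;0)=\frac{1}{\sqrt{2\pi}}e^{-x^2/2}$ and with $\log f(x;\theta)$ continuously differentiable in $\theta\ge 0$ including the boundary $\theta=0$. Assume that for some $\epsilon>0$ $$\int_0^\infty\int_{-\infty}^\infty g(a,b;\epsilon)^n\exp\Big(-\frac{n(a^2+b^2)}{2}\Big)b^{n-2}\,da\,db<\infty,\qquad g(a,b;\epsilon)=\sup_{|z|\le\sqrt n,\;0\le\theta\le\epsilon}\frac{\left|\frac{\partial}{\partial\theta}f(a+bz;\theta)\right|}{f(a+bz;0)} .$$ Put $$T(z_1,\ldots,z_n)=\int_0^\infty\int_{-\infty}^\infty\sum_{i=1}^n l_\theta(a+bz_i;0)\exp\Big(-\frac{n(a^2+b^2)}{2}\Big)b^{n-2}\,da\,db ,$$ where $l_\theta(x;0)=\frac{\partial}{\partial\theta}\log f(x;\theta)\big|_{\theta=0}$ and $z_1,\ldots,z_n$ are the standardized observations. Then the unique rejection region of the locally best invariant test of normality $H_0:\theta=0$ against $H_1:\theta>0$ is given by $$T(z_1,\ldots,z_n)>k ,$$ provided that $P_0(T(z_1,\ldots,z_n)=k)=0$ under $H_0$.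
   Context: For $\theta\ge 0$ let $f(\cdot;\theta)$ be a probability density on $\mathbb{R}$ and let $f_{a,b}(x;\theta)=\frac1b f\left(\frac{x-a}{b};\theta\right)$, $-\infty<a<\infty$, $b>0$, so that $f=f_{0,1}$. The value $\theta=0$ corresponds to the normal location-scale family. The observations $x_1,\dots,x_n$ are i.i.d. from $f_{a,b}(x;\theta)$ with $a,b,\theta$ unknown. The standardized observations are $z_i=(x_i-\bar x)/s$, where $\bar x=\frac1n\sum_j x_j$ and $s^2=\frac1n\sum_{j}(x_j-\bar x)^2$. A critical (rejection) region $R\subset\mathbb{R}^n$ is invariant if $(x_1,\dots,x_n)\in R\Leftrightarrow(a+bx_1,\dots,a+bx_n)\in R$ for all $a\in\mathbb{R}$, $b>0$; the probability $P_\theta(R)$ of an invariant region depends only on $\theta$, not on $(a,b)$. An invariant region $R$ is the rejection region of a locally best invariant (LBI) test (of size $P_0(R)$) if for every invariant region $R'$ with $P_0(R')\le P_0(R)$ there is $\theta_0>0$ such that $P_\theta(R)\ge P_\theta(R')$ for all $0<\theta<\theta_0$. Uniqueness is understood among regions of the same size and up to null sets. *)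

theory Defs
  imports "HOL-Probability.Probability"
begin

text \<open>
  A family is a function \<open>f :: real \<Rightarrow> real \<Rightarrow> real\<close>, where \<open>f x \<theta>\<close> is the value at \<open>x\<close> of the
  density with parameter \<open>\<theta>\<close>; only the values with \<open>\<theta> \<ge> 0\<close> matter. A sample of size \<open>n\<close> is an
  element of \<open>{..<n} \<rightarrow>\<^sub>E UNIV\<close>, that is, a function that is \<open>undefined\<close> outside \<open>{..<n}\<close>.
\<close>

definition loc_scale :: "(real \<Rightarrow> real \<Rightarrow> real) \<Rightarrow> real \<Rightarrow> real \<Rightarrow> real \<Rightarrow> real \<Rightarrow> real" where
  "loc_scale f a b x \<theta> = 1 / b * f ((x - a) / b) \<theta>"

definition sample_law ::
    "(real \<Rightarrow> real \<Rightarrow> real) \<Rightarrow> nat \<Rightarrow> real \<Rightarrow> real \<Rightarrow> real \<Rightarrow> (nat \<Rightarrow> real) measure" where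
  "sample_law f n a b \<theta> =
     (\<Pi>\<^sub>M i\<in>{..<n}. density lborel (\<lambda>x. ennreal (loc_scale f a b x \<theta>)))"

definition invariant_region :: "nat \<Rightarrow> (nat \<Rightarrow> real) set \<Rightarrow> bool" where
  "invariant_region n R \<longleftrightarrow>
     R \<in> sets (\<Pi>\<^sub>M i\<in>{..<n}. (borel :: real measure)) \<and>
     (\<forall>a b. b > 0 \<longrightarrow>
        (\<forall>x \<in> {..<n} \<rightarrow>\<^sub>E UNIV. x \<in> R \<longleftrightarrow> (\<lambda>i\<in>{..<n}. a + b * x i) \<in> R))"

text \<open>
  The rejection probability is defined at \<open>a = 0\<close>, \<open>b = 1\<close>; for an invariant region it is the
  same for all \<open>a\<close> and \<open>b > 0\<close>, by \<open>rejection_prob_loc_scale\<close> below.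
\<close>

definition rejection_prob ::
    "(real \<Rightarrow> real \<Rightarrow> real) \<Rightarrow> nat \<Rightarrow> real \<Rightarrow> (nat \<Rightarrow> real) set \<Rightarrow> real" where
  "rejection_prob f n \<theta> R = measure (sample_law f n 0 1 \<theta>) R"

definition LBI_region :: "(real \<Rightarrow> real \<Rightarrow> real) \<Rightarrow> nat \<Rightarrow> (nat \<Rightarrow> real) set \<Rightarrow> bool" where
  "LBI_region f n R \<longleftrightarrow>
     invariant_region n R \<and>
     (\<forall>R'. invariant_region n R' \<longrightarrow> rejection_prob f n 0 R' \<le> rejection_prob f n 0 R \<longrightarrow>
        (\<exists>\<theta>\<^sub>0>0. \<forall>\<theta>. 0 < \<theta> \<and> \<theta> < \<theta>\<^sub>0 \<longrightarrow>
           rejection_prob f n \<theta> R' \<le> rejection_prob f n \<theta> R))"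

definition sample_mean :: "nat \<Rightarrow> (nat \<Rightarrow> real) \<Rightarrow> real" where
  "sample_mean n x = (\<Sum>j<n. x j) / real n"

definition sample_sd :: "nat \<Rightarrow> (nat \<Rightarrow> real) \<Rightarrow> real" where
  "sample_sd n x = sqrt ((\<Sum>j<n. (x j - sample_mean n x)\<^sup>2) / real n)"

definition standardized :: "nat \<Rightarrow> (nat \<Rightarrow> real) \<Rightarrow> nat \<Rightarrow> real" where
  "standardized n x i = (x i - sample_mean n x) / sample_sd n x"

text \<open>
  Derivatives in \<open>\<theta>\<close> are taken within \<open>{0..}\<close>, hence one-sided at \<open>\<theta> = 0\<close>.
\<close>

definition f_theta :: "(real \<Rightarrow> real \<Rightarrow> real) \<Rightarrow> real \<Rightarrow> real \<Rightarrow> real" where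
  "f_theta f x \<theta> = vector_derivative (\<lambda>t. f x t) (at \<theta> within {0..})"

definition l_theta :: "(real \<Rightarrow> real \<Rightarrow> real) \<Rightarrow> real \<Rightarrow> real \<Rightarrow> real" where
  "l_theta f x \<theta> = vector_derivative (\<lambda>t. ln (f x t)) (at \<theta> within {0..})"

text \<open>
  The supremum is taken in \<^typ>\<open>ennreal\<close>, so that it is \<open>\<infinity>\<close> when the ratios are unbounded.
\<close>

definition g_bound :: "(real \<Rightarrow> real \<Rightarrow> real) \<Rightarrow> nat \<Rightarrow> real \<Rightarrow> real \<Rightarrow> real \<Rightarrow> ennreal" where
  "g_bound f n a b \<epsilon> =
     (SUP (z, \<theta>) \<in> {- sqrt (real n)..sqrt (real n)} \<times> {0..\<epsilon>}.
        ennreal (\<bar>f_theta f (a + b * z) \<theta>\<bar> / f (a + b * z) 0))"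

definition T_stat :: "(real \<Rightarrow> real \<Rightarrow> real) \<Rightarrow> nat \<Rightarrow> (nat \<Rightarrow> real) \<Rightarrow> real" where
  "T_stat f n z =
     (LBINT b:{0<..}. (LBINT a.
        (\<Sum>i<n. l_theta f (a + b * z i) 0) *
        exp (- (real n * (a\<^sup>2 + b\<^sup>2) / 2)) * b ^ (n - 2)))"

lemma density_loc_scale:
  assumes [measurable]: "(\<lambda>x. f x \<theta>) \<in> borel_measurable borel" and b: "b > 0"
  shows "density lborel (\<lambda>x. ennreal (loc_scale f a b x \<theta>)) =
           distr (density lborel (\<lambda>x. ennreal (loc_scale f 0 1 x \<theta>))) lborel (\<lambda>x. a + b * x)"
proof -
  have m[measurable]: "(\<lambda>x. loc_scale f a b x \<theta>) \<in> borel_measurable borel"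
    unfolding loc_scale_def by measurable
  have "density lborel (\<lambda>x. ennreal (loc_scale f a b x \<theta>)) =
          density (density (distr lborel borel (\<lambda>x. a + b * x)) (\<lambda>_. ennreal \<bar>b\<bar>))
            (\<lambda>x. ennreal (loc_scale f a b x \<theta>))"
    using lborel_real_affine[of b a] b by simp
  also have "\<dots> = density (distr lborel borel (\<lambda>x. a + b * x))
                     (\<lambda>x. ennreal \<bar>b\<bar> * ennreal (loc_scale f a b x \<theta>))"
    by (subst density_density_eq) auto
  also have "\<dots> = distr (density lborel
                     (\<lambda>x. ennreal \<bar>b\<bar> * ennreal (loc_scale f a b (a + b * x) \<theta>))) borel (\<lambda>x. a + b * x)"
    by (subst density_distr) auto
  also have "(\<lambda>x. ennreal \<bar>b\<bar> * ennreal (loc_scale f a b (a + b * x) \<theta>)) =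
             (\<lambda>x. ennreal (loc_scale f 0 1 x \<theta>))"
    using b by (auto simp: loc_scale_def fun_eq_iff ennreal_mult'[symmetric])
  also have "distr (density lborel (\<lambda>x. ennreal (loc_scale f 0 1 x \<theta>))) borel (\<lambda>x. a + b * x) =
             distr (density lborel (\<lambda>x. ennreal (loc_scale f 0 1 x \<theta>))) lborel (\<lambda>x. a + b * x)"
    by (rule distr_cong) auto
  finally show ?thesis .
qed

lemma rejection_prob_loc_scale:
  assumes f [measurable]: "(\<lambda>x. f x \<theta>) \<in> borel_measurable borel"
    and int: "(\<integral>\<^sup>+ x. ennreal (f x \<theta>) \<partial>lborel) = 1"
    and b: "b > 0" and R: "invariant_region n R"
  shows "measure (sample_law f n a b \<theta>) R = rejection_prob f n \<theta> R"
proof -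
  let ?N = "density lborel (\<lambda>x. ennreal (loc_scale f 0 1 x \<theta>))"
  let ?h = "compose {..<n} (\<lambda>x. a + b * x)"
  have N: "prob_space ?N"
    using int by (intro prob_spaceI) (simp add: emeasure_density loc_scale_def)
  have N': "prob_space (distr ?N lborel (\<lambda>x. a + b * x))"
    by (intro prob_space.prob_space_distr[OF N]) auto
  have RB: "R \<in> sets (\<Pi>\<^sub>M i\<in>{..<n}. (lborel :: real measure))"
    using R by (simp add: invariant_region_def cong: sets_PiM_cong)
  let ?D = "distr ?N lborel (\<lambda>x. a + b * x)"
  have "sample_law f n a b \<theta> = (\<Pi>\<^sub>M i\<in>{..<n}. ?D)"
    unfolding sample_law_def using density_loc_scale[of f \<theta>, OF f b] by simp
  also have "\<dots> = (\<Pi>\<^sub>M i\<in>{..<n}. distr ?N ?D (\<lambda>x. a + b * x))"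
    by (intro PiM_cong distr_cong) auto
  also have "\<dots> = distr (\<Pi>\<^sub>M i\<in>{..<n}. ?N) (\<Pi>\<^sub>M i\<in>{..<n}. ?D) ?h"
    by (rule distr_PiM_finite_prob_space'[symmetric]) (use N N' in auto)
  also have "\<dots> = distr (\<Pi>\<^sub>M i\<in>{..<n}. ?N) (\<Pi>\<^sub>M i\<in>{..<n}. lborel) ?h"
    by (intro distr_cong sets_PiM_cong) auto
  finally have eq: "sample_law f n a b \<theta> = distr (sample_law f n 0 1 \<theta>) (\<Pi>\<^sub>M i\<in>{..<n}. lborel) ?h"
    by (simp add: sample_law_def)
  have h: "?h \<in> measurable (sample_law f n 0 1 \<theta>) (\<Pi>\<^sub>M i\<in>{..<n}. lborel)"
    unfolding sample_law_def compose_def by measurable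
  have sp: "space (sample_law f n 0 1 \<theta>) = {..<n} \<rightarrow>\<^sub>E UNIV"
    by (simp add: sample_law_def space_PiM)
  have sub: "R \<subseteq> {..<n} \<rightarrow>\<^sub>E UNIV"
    using sets.sets_into_space[OF RB] by (simp add: space_PiM)
  have "?h -` R \<inter> space (sample_law f n 0 1 \<theta>) = R"
    using R b sub unfolding sp invariant_region_def compose_def by blast
  with measure_distr[OF h RB] show ?thesis
    by (simp add: eq rejection_prob_def)
qed

end

theory Submission
  imports Defs
begin

text \<open>
  Only the orbit of a sample under the affine maps \<open>x \<mapsto> a + b x\<close> with \<open>b > 0\<close> matters for an invariant
  region \<open>R\<close>, so its rejection probability can be computed from the likelihood integrated along
  orbits. Let \<open>z\<close> denote the standardized sample, let \<open>\<mu>\<close> be the measure on the half plane \<open>b > 0\<close> with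
  density \<open>exp (- n (a\<^sup>2 + b\<^sup>2) / 2) b ^ (n - 2)\<close>, and let \<open>W\<close> be its total mass. Then
  \<open>W P\<^sub>\<theta>(R)\<close> is the integral over \<open>x \<in> R\<close>, under \<open>P\<^sub>0\<close>, of
  \<open>\<integral> \<Prod>i. f(a + b z\<^sub>i; \<theta>) / f(a + b z\<^sub>i; 0) d\<mu>\<close>
  (\<open>emeasure_P_eq_ratio_integral\<close>). The weight is Gaussian because standardized observations have sum 0
  and sum of squares \<open>n\<close>. The formula comes from Tonelli's theorem and affine substitutions in the
  group and in the sample space (\<open>nn_integral_invariant_region\<close>), so that no coordinates on the space of
  orbits are introduced.

  The \<open>\<theta>\<close>-derivative of the inner product at 0 is the sum of the scores, whose \<open>\<mu>\<close>-integral is the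
  statistic \<open>T\<close>. Differentiation under both integrals is justified by the mean value theorem in each
  factor and by convexity: the difference quotient of the product is at most \<open>(1 + \<epsilon> g) ^ n / \<epsilon>\<close>
  (\<open>abs_difference_quotient_le\<close>), which is \<open>\<mu>\<close>-integrable by the assumption on \<open>g\<close> and is the same for all
  samples. Hence the derivative of \<open>P\<^sub>\<theta>(R)\<close> at \<open>\<theta> = 0\<close> is the integral of \<open>T\<close> over \<open>R\<close> under \<open>P\<^sub>0\<close>, divided
  by \<open>W\<close> (\<open>rejection_prob_derivative\<close>).

  What remains is the Neyman-Pearson argument for these slopes (\<open>slope_le_region\<close>). A competitor of
  strictly smaller size loses for small \<open>\<theta>\<close> by continuity. For a competitor \<open>R'\<close> of equal size the difference of
  slopes is, up to the factor \<open>1 / W\<close>, the integral of \<open>(1_R - 1_R') (T - k)\<close> under \<open>P\<^sub>0\<close>. It is nonnegative, and it is 0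
  only if the regions agree up to null sets, since \<open>T = k\<close> has probability 0.
\<close>

section \<open>Finite powers of Lebesgue measure\<close>

text \<open>
  Both sides are measures on the product that agree on boxes, where Tonelli's theorem factorizes the
  integral of the product density.
\<close>

lemma density_PiM:
  fixes M :: "'i \<Rightarrow> 'a measure" and h :: "'i \<Rightarrow> 'a \<Rightarrow> ennreal"
  assumes I: "finite I" and sf: "\<And>i. sigma_finite_measure (M i)"
    and h: "\<And>i. h i \<in> borel_measurable (M i)"
    and sfh: "\<And>i. sigma_finite_measure (density (M i) (h i))"
  shows "(\<Pi>\<^sub>M i\<in>I. density (M i) (h i)) =
           density (\<Pi>\<^sub>M i\<in>I. M i) (\<lambda>x. \<Prod>i\<in>I. h i (x i))"
proof -
  interpret M: product_sigma_finite M by (simp add: product_sigma_finite_def sf)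
  interpret D: product_sigma_finite "\<lambda>i. density (M i) (h i)"
    by (simp add: product_sigma_finite_def sfh)
  note h[measurable]
  show ?thesis
  proof (rule D.PiM_eqI[symmetric, OF I])
    show "sets (density (Pi\<^sub>M I M) (\<lambda>x. \<Prod>i\<in>I. h i (x i))) =
          sets (\<Pi>\<^sub>M i\<in>I. density (M i) (h i))"
      by (simp cong: sets_PiM_cong)
    fix A assume "\<And>i. i \<in> I \<Longrightarrow> A i \<in> sets (density (M i) (h i))"
    then have A[measurable]: "\<And>i. i \<in> I \<Longrightarrow> A i \<in> sets (M i)" by simp
    have "emeasure (density (Pi\<^sub>M I M) (\<lambda>x. \<Prod>i\<in>I. h i (x i))) (Pi\<^sub>E I A) =
        (\<integral>\<^sup>+x. (\<Prod>i\<in>I. h i (x i)) * indicator (Pi\<^sub>E I A) x \<partial>Pi\<^sub>M I M)"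
      using I by (intro emeasure_density) auto
    also have "\<dots> = (\<integral>\<^sup>+x. (\<Prod>i\<in>I. h i (x i) * indicator (A i) (x i)) \<partial>Pi\<^sub>M I M)"
    proof (rule nn_integral_cong)
      fix x assume "x \<in> space (Pi\<^sub>M I M)"
      then have "indicator (Pi\<^sub>E I A) x = (\<Prod>i\<in>I. indicator (A i) (x i) :: ennreal)"
        using I by (cases "x \<in> Pi\<^sub>E I A") (auto simp: space_PiM PiE_iff indicator_def)
      then show "(\<Prod>i\<in>I. h i (x i)) * indicator (Pi\<^sub>E I A) x =
                 (\<Prod>i\<in>I. h i (x i) * indicator (A i) (x i))"
        by (simp add: prod.distrib)
    qed
    also have "\<dots> = (\<Prod>i\<in>I. \<integral>\<^sup>+y. h i y * indicator (A i) y \<partial>M i)"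
      using I by (intro M.product_nn_integral_prod) auto
    also have "\<dots> = (\<Prod>i\<in>I. emeasure (density (M i) (h i)) (A i))"
      using A by (intro prod.cong) (auto simp: emeasure_density)
    finally show "emeasure (density (Pi\<^sub>M I M) (\<lambda>x. \<Prod>i\<in>I. h i (x i))) (Pi\<^sub>E I A) =
        (\<Prod>i\<in>I. emeasure (density (M i) (h i)) (A i))" .
  qed
qed

text \<open>
  The change of variables \<open>y = a + b x\<close> in all coordinates at once. Each coordinate contributes a
  factor \<open>b\<close>, which is read off on boxes from the one-dimensional affine image of Lebesgue measure.
\<close>

lemma nn_integral_PiM_lborel_affine:
  fixes h :: "('i \<Rightarrow> real) \<Rightarrow> ennreal"
  assumes I: "finite I" and b: "b > 0"
    and h [measurable]: "h \<in> borel_measurable (\<Pi>\<^sub>M i\<in>I. lborel)"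
  shows "(\<integral>\<^sup>+x. h x \<partial>(\<Pi>\<^sub>M i\<in>I. lborel)) =
           ennreal (b ^ card I) * (\<integral>\<^sup>+x. h (\<lambda>i\<in>I. a + b * x i) \<partial>(\<Pi>\<^sub>M i\<in>I. lborel))"
proof -
  let ?L = "\<Pi>\<^sub>M i\<in>I. (lborel :: real measure)"
  let ?g = "\<lambda>x. \<lambda>i\<in>I. a + b * x i"
  interpret L: product_sigma_finite "\<lambda>_::'i. lborel :: real measure" by standard
  have g[measurable]: "?g \<in> measurable ?L ?L" by measurable
  have "density (distr ?L ?L ?g) (\<lambda>_. ennreal (b ^ card I)) = ?L"
  proof (rule L.PiM_eqI[OF I])
    show "sets (density (distr ?L ?L ?g) (\<lambda>_. ennreal (b ^ card I))) = sets ?L" by simp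
    fix A assume A: "\<And>i. i \<in> I \<Longrightarrow> A i \<in> sets (lborel :: real measure)"
    then have PA [measurable]: "Pi\<^sub>E I A \<in> sets ?L" using I by (intro sets_PiM_I_finite) auto
    have vim: "?g -` Pi\<^sub>E I A \<inter> space ?L = Pi\<^sub>E I (\<lambda>i. (\<lambda>y. a + b * y) -` A i)"
      by (auto simp: space_PiM PiE_iff)
    have mb: "(\<lambda>y. a + b * y) -` A i \<in> sets (lborel :: real measure)" if "i \<in> I" for i
      using measurable_sets[of "\<lambda>y. a + b * y" borel borel "A i"] A[OF that] by simp
    have one: "emeasure lborel (A i) = ennreal b * emeasure lborel ((\<lambda>y. a + b * y) -` A i)"
      if i: "i \<in> I" for i
    proof -
      have "emeasure lborel (A i) =
          emeasure (density (distr lborel borel (\<lambda>x. a + b * x)) (\<lambda>_. ennreal \<bar>b\<bar>)) (A i)"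
        using lborel_real_affine[of b a] b by simp
      also have "\<dots> = ennreal b * emeasure lborel ((\<lambda>y. a + b * y) -` A i)"
        using A[OF i] b by (simp add: emeasure_density nn_integral_cmult emeasure_distr)
      finally show ?thesis .
    qed
    have "emeasure (density (distr ?L ?L ?g) (\<lambda>_. ennreal (b ^ card I))) (Pi\<^sub>E I A) =
        ennreal (b ^ card I) * emeasure ?L (Pi\<^sub>E I (\<lambda>i. (\<lambda>y. a + b * y) -` A i))"
      by (simp add: emeasure_density nn_integral_cmult emeasure_distr vim)
    also have "\<dots> = (\<Prod>i\<in>I. ennreal b * emeasure lborel ((\<lambda>y. a + b * y) -` A i))"
      using b mb I by (simp add: L.emeasure_PiM prod.distrib ennreal_power)
    also have "\<dots> = (\<Prod>i\<in>I. emeasure lborel (A i))"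
      by (intro prod.cong refl one[symmetric])
    finally show "emeasure (density (distr ?L ?L ?g) (\<lambda>_. ennreal (b ^ card I))) (Pi\<^sub>E I A) =
        (\<Prod>i\<in>I. emeasure lborel (A i))" .
  qed
  then have "(\<integral>\<^sup>+x. h x \<partial>?L) =
      (\<integral>\<^sup>+x. h x \<partial>density (distr ?L ?L ?g) (\<lambda>_. ennreal (b ^ card I)))" by simp
  also have "\<dots> = ennreal (b ^ card I) * (\<integral>\<^sup>+x. h (?g x) \<partial>?L)"
    by (simp add: nn_integral_density nn_integral_distr nn_integral_cmult)
  finally show ?thesis .
qed

text \<open>
  With every other coordinate fixed, the \<open>i\<close>-th one has to hit a single point.
\<close>

lemma AE_PiM_lborel_coordinates_neq:
  assumes I: "finite I" and ij: "i \<in> I" "j \<in> I" "i \<noteq> j"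
  shows "AE x in (\<Pi>\<^sub>M i\<in>I. (lborel :: real measure)). x i \<noteq> x j"
proof -
  interpret L: product_sigma_finite "\<lambda>_::'a. lborel :: real measure" by standard
  define J where "J = I - {i}"
  have J: "I = insert i J" "i \<notin> J" "finite J" "j \<in> J" using I ij by (auto simp: J_def)
  define N where "N = {x \<in> space (\<Pi>\<^sub>M i\<in>I. (lborel :: real measure)). x i = x j}"
  have N[measurable]: "N \<in> sets (\<Pi>\<^sub>M i\<in>I. (lborel :: real measure))"
    unfolding N_def using ij by measurable
  have "emeasure (\<Pi>\<^sub>M i\<in>I. lborel) N = (\<integral>\<^sup>+x. indicator N x \<partial>(\<Pi>\<^sub>M i\<in>I. lborel))" by simp
  also have "\<dots> = (\<integral>\<^sup>+x. (\<integral>\<^sup>+y. indicator N (x(i := y)) \<partial>lborel) \<partial>(\<Pi>\<^sub>M i\<in>J. lborel))"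
    unfolding J(1) using J N by (intro L.product_nn_integral_insert) auto
  also have "\<dots> = (\<integral>\<^sup>+x. (\<integral>\<^sup>+y. indicator {x j} y \<partial>lborel) \<partial>(\<Pi>\<^sub>M i\<in>J. (lborel :: real measure)))"
  proof (intro nn_integral_cong)
    fix x y assume "x \<in> space (\<Pi>\<^sub>M i\<in>J. (lborel :: real measure))"
    then show "indicator N (x(i := y)) = (indicator {x j} y :: ennreal)"
      using J ij(3) by (auto simp: N_def space_PiM PiE_iff indicator_def extensional_def)
  qed
  also have "\<dots> = 0" by simp
  finally have "N \<in> null_sets (\<Pi>\<^sub>M i\<in>I. lborel)" by auto
  then show ?thesis by (rule AE_I') (auto simp: N_def)
qed

section \<open>Standardized samples\<close>

lemma sample_mean_affine:
  assumes "n > 0"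
  shows "sample_mean n (\<lambda>i\<in>{..<n}. a + b * x i) = a + b * sample_mean n x"
  using assms by (simp add: sample_mean_def sum.distrib sum_distrib_left[symmetric] field_simps)

lemma sample_sd_affine:
  assumes "n > 0" "b \<ge> 0"
  shows "sample_sd n (\<lambda>i\<in>{..<n}. a + b * x i) = b * sample_sd n x"
proof -
  have "(\<Sum>j<n. ((\<lambda>i\<in>{..<n}. a + b * x i) j - (a + b * sample_mean n x))\<^sup>2) =
        b\<^sup>2 * (\<Sum>j<n. (x j - sample_mean n x)\<^sup>2)"
    by (simp add: sum_distrib_left power_mult_distrib[symmetric] algebra_simps)
  then show ?thesis
    using assms unfolding sample_sd_def sample_mean_affine[OF assms(1)]
    by (simp only: times_divide_eq_right[symmetric] real_sqrt_mult) simp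
qed

lemma standardized_affine:
  assumes "n > 0" "b > 0" "i < n"
  shows "standardized n (\<lambda>i\<in>{..<n}. a + b * x i) i = standardized n x i"
proof -
  have "(a + b * x i - (a + b * sample_mean n x)) / (b * sample_sd n x) =
        (b * (x i - sample_mean n x)) / (b * sample_sd n x)"
    by (simp add: algebra_simps)
  then show ?thesis
    using assms by (simp add: standardized_def sample_mean_affine sample_sd_affine)
qed

text \<open>
  The cross term vanishes because deviations from the mean sum to zero. Consequently the joint normal
  density of a sample is a function of its mean and standard deviation only.
\<close>

lemma sum_power2_affine_sample:
  assumes n: "n > 0"
  shows "(\<Sum>i<n. (a + b * x i)\<^sup>2) =
    real n * ((a + b * sample_mean n x)\<^sup>2 + (b * sample_sd n x)\<^sup>2)"
proof -
  let ?m = "sample_mean n x" and ?s = "sample_sd n x"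
  have sx: "(\<Sum>i<n. x i) = real n * ?m" using n by (simp add: sample_mean_def)
  have ss: "(\<Sum>i<n. (x i - ?m)\<^sup>2) = real n * ?s\<^sup>2"
    using n by (simp add: sample_sd_def sum_nonneg)
  have "(\<Sum>i<n. (a + b * x i)\<^sup>2) =
      (\<Sum>i<n. (a + b * ?m)\<^sup>2 + (b\<^sup>2 * (x i - ?m)\<^sup>2 + (2 * (a + b * ?m) * b) * (x i - ?m)))"
    by (intro sum.cong refl) (simp add: power2_eq_square algebra_simps)
  also have "\<dots> = real n * (a + b * ?m)\<^sup>2 + (b\<^sup>2 * (real n * ?s\<^sup>2) +
      (2 * (a + b * ?m) * b) * ((\<Sum>i<n. x i) - real n * ?m))"
    by (simp only: sum.distrib sum_distrib_left[symmetric] ss sum_subtractf) simp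
  also have "\<dots> = real n * ((a + b * ?m)\<^sup>2 + (b * ?s)\<^sup>2)"
    unfolding sx by (simp add: algebra_simps power_mult_distrib)
  finally show ?thesis .
qed

lemma sum_standardized:
  assumes "n > 0" "sample_sd n x > 0"
  shows "(\<Sum>i<n. standardized n x i) = 0" "(\<Sum>i<n. (standardized n x i)\<^sup>2) = real n"
proof -
  have "(\<Sum>i<n. x i) = real n * sample_mean n x" using assms by (simp add: sample_mean_def)
  then show "(\<Sum>i<n. standardized n x i) = 0"
    by (simp add: standardized_def sum_divide_distrib[symmetric] sum_subtractf)
  have "(\<Sum>i<n. (x i - sample_mean n x)\<^sup>2) = real n * (sample_sd n x)\<^sup>2"
    using assms by (simp add: sample_sd_def sum_nonneg)
  then show "(\<Sum>i<n. (standardized n x i)\<^sup>2) = real n"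
    using assms by (simp add: standardized_def power_divide sum_divide_distrib[symmetric])
qed

text \<open>
  Every standardized sample has mean 0 and standard deviation 1, so along the orbit of any sample the
  normal likelihood is the same function of \<open>(a, b)\<close>. This is why one and the same Gaussian weight
  serves for all samples in the test statistic.
\<close>

lemma sum_power2_affine_standardized:
  assumes "n > 0" "sample_sd n x > 0"
  shows "(\<Sum>i<n. (a + b * standardized n x i)\<^sup>2) = real n * (a\<^sup>2 + b\<^sup>2)"
proof -
  have "(\<Sum>i<n. (a + b * standardized n x i)\<^sup>2) =
     (\<Sum>i<n. a\<^sup>2 + ((2 * a * b) * standardized n x i + b\<^sup>2 * (standardized n x i)\<^sup>2))"
    by (intro sum.cong refl) (simp add: power2_eq_square algebra_simps)
  also have "\<dots> = real n * (a\<^sup>2 + b\<^sup>2)"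
    by (simp only: sum.distrib sum_distrib_left[symmetric] sum_standardized[OF assms])
      (simp add: algebra_simps)
  finally show ?thesis .
qed

text \<open>
  The bound \<open>sqrt n\<close> on the standardized observations is never attained: a coordinate of modulus
  \<open>sqrt n\<close> would exhaust the sum of squares \<open>n\<close>, force the others to be 0, and contradict the sum being
  0. The strict inequality is what allows a supremum over an open interval further below.
\<close>

lemma abs_standardized_less:
  assumes "n > 0" "sample_sd n x > 0" "i < n"
  shows "\<bar>standardized n x i\<bar> < sqrt (real n)"
proof (rule ccontr)
  let ?z = "standardized n x"
  note z = sum_standardized[OF assms(1,2)]
  assume "\<not> \<bar>?z i\<bar> < sqrt (real n)"
  then have zi: "(?z i)\<^sup>2 \<ge> real n"
    by (metis linorder_not_less real_less_rsqrt power2_abs)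
  have "(\<Sum>j<n. (?z j)\<^sup>2) = (?z i)\<^sup>2 + (\<Sum>j\<in>{..<n} - {i}. (?z j)\<^sup>2)"
    using assms(3) by (subst sum.remove[of _ i]) auto
  moreover have "(\<Sum>j\<in>{..<n} - {i}. (?z j)\<^sup>2) \<ge> 0" by (intro sum_nonneg) auto
  ultimately have "(\<Sum>j\<in>{..<n} - {i}. (?z j)\<^sup>2) = 0" using z(2) zi by linarith
  then have "\<forall>j\<in>{..<n} - {i}. ?z j = 0" by (subst (asm) sum_nonneg_eq_0_iff) auto
  then have "(\<Sum>j<n. ?z j) = ?z i"
    using assms(3) by (subst sum.remove[of _ i]) auto
  with z(1) zi assms(1) show False by simp
qed

lemma sample_sd_pos:
  assumes "i < n" "j < n" "x i \<noteq> x j"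
  shows "sample_sd n x > 0"
proof (rule ccontr)
  assume "\<not> sample_sd n x > 0"
  then have "(\<Sum>k<n. (x k - sample_mean n x)\<^sup>2) / real n \<le> 0" by (simp add: sample_sd_def)
  moreover have "(\<Sum>k<n. (x k - sample_mean n x)\<^sup>2) \<ge> 0" by (intro sum_nonneg) auto
  ultimately have "(\<Sum>k<n. (x k - sample_mean n x)\<^sup>2) = 0"
    using assms(1) by (simp add: divide_le_0_iff)
  then have "\<forall>k<n. (x k - sample_mean n x)\<^sup>2 = 0" by (subst (asm) sum_nonneg_eq_0_iff) auto
  with assms show False by auto
qed

lemma measurable_sample_mean [measurable]:
  "sample_mean n \<in> borel_measurable (\<Pi>\<^sub>M i\<in>{..<n}. lborel)"
  unfolding sample_mean_def by measurable

lemma measurable_sample_sd [measurable]: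
  "sample_sd n \<in> borel_measurable (\<Pi>\<^sub>M i\<in>{..<n}. lborel)"
  unfolding sample_sd_def by measurable

lemma measurable_standardized [measurable]:
  "i < n \<Longrightarrow> (\<lambda>x. standardized n x i) \<in> borel_measurable (\<Pi>\<^sub>M i\<in>{..<n}. lborel)"
  unfolding standardized_def by measurable

lemma AE_sample_sd_pos:
  assumes "n \<ge> 2"
  shows "AE x in (\<Pi>\<^sub>M i\<in>{..<n}. (lborel :: real measure)). sample_sd n x > 0"
proof -
  have "AE x in (\<Pi>\<^sub>M i\<in>{..<n}. (lborel :: real measure)). x 0 \<noteq> x 1"
    using assms by (intro AE_PiM_lborel_coordinates_neq) auto
  then show ?thesis by eventually_elim (use assms in \<open>auto intro: sample_sd_pos[of 0 n 1]\<close>)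
qed


section \<open>Integration over the orbits of the affine group\<close>

abbreviation lborel_n :: "nat \<Rightarrow> (nat \<Rightarrow> real) measure" where
  "lborel_n n \<equiv> \<Pi>\<^sub>M i\<in>{..<n}. lborel"

text \<open>
  Points of the half plane are written \<open>(b, a)\<close>, scale first, and stand for the map \<open>x \<mapsto> a + b x\<close>. The
  substitution covers composition with a fixed affine map on either side: one side scales both
  coordinates, the other scales \<open>b\<close> and shears \<open>a\<close>.
\<close>

lemma nn_integral_half_plane_affine:
  fixes F :: "real \<Rightarrow> real \<Rightarrow> ennreal"
  assumes [measurable]: "(\<lambda>(b, a). F b a) \<in> borel_measurable (lborel \<Otimes>\<^sub>M lborel)"
    and cd: "c > 0" "d > 0"
  shows "(\<integral>\<^sup>+(b, a). indicator {0<..} b * F b a \<partial>(lborel \<Otimes>\<^sub>M lborel)) =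
         ennreal (c * d) * (\<integral>\<^sup>+(b, a). indicator {0<..} b * F (c * b) (m + d * a + e * b)
           \<partial>(lborel \<Otimes>\<^sub>M lborel))"
proof -
  have [measurable]: "(\<lambda>(b, a). F b a) \<in> borel_measurable (borel \<Otimes>\<^sub>M borel)"
    using assms(1) by simp
  have "(\<integral>\<^sup>+(b, a). indicator {0<..} b * F b a \<partial>(lborel \<Otimes>\<^sub>M lborel)) =
      (\<integral>\<^sup>+b. indicator {0<..} b * (\<integral>\<^sup>+a. F b a \<partial>lborel) \<partial>lborel)"
    by (subst lborel.nn_integral_fst[symmetric]) (auto simp: nn_integral_cmult)
  also have "\<dots> = ennreal c *
      (\<integral>\<^sup>+b. indicator {0<..} (c * b) * (\<integral>\<^sup>+a. F (c * b) a \<partial>lborel) \<partial>lborel)"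
    using cd by (subst nn_integral_real_affine[where c=c and t=0]) auto
  also have "\<dots> = ennreal c *
      (\<integral>\<^sup>+b. ennreal d * (\<integral>\<^sup>+a. indicator {0<..} b * F (c * b) (m + d * a + e * b) \<partial>lborel) \<partial>lborel)"
  proof (intro arg_cong[where f="\<lambda>x. ennreal c * x"] nn_integral_cong)
    fix b
    have "(\<integral>\<^sup>+a. F (c * b) a \<partial>lborel) = ennreal d * (\<integral>\<^sup>+a. F (c * b) ((m + e * b) + d * a) \<partial>lborel)"
      using cd by (subst nn_integral_real_affine[where c=d and t="m + e * b"]) auto
    moreover have "indicator {0<..} (c * b) = (indicator {0<..} b :: ennreal)"
      using cd by (auto simp: indicator_def zero_less_mult_iff)
    ultimately show "indicator {0<..} (c * b) * (\<integral>\<^sup>+a. F (c * b) a \<partial>lborel) =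
        ennreal d * (\<integral>\<^sup>+a. indicator {0<..} b * F (c * b) (m + d * a + e * b) \<partial>lborel)"
      by (simp add: nn_integral_cmult algebra_simps)
  qed
  also have "\<dots> = ennreal (c * d) *
      (\<integral>\<^sup>+b. (\<integral>\<^sup>+a. indicator {0<..} b * F (c * b) (m + d * a + e * b) \<partial>lborel) \<partial>lborel)"
    using cd by (simp add: nn_integral_cmult ennreal_mult mult.assoc)
  also have "\<dots> = ennreal (c * d) * (\<integral>\<^sup>+(b, a). indicator {0<..} b * F (c * b) (m + d * a + e * b)
           \<partial>(lborel \<Otimes>\<^sub>M lborel))"
    by (subst lborel.nn_integral_fst[symmetric]) auto
  finally show ?thesis .
qed

text \<open>
  A sample and its standardization lie on the same orbit; substituting the affine map between them
  in the integral over the group costs the power \<open>n - 1\<close> of the standard deviation.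
\<close>

lemma orbit_integral_standardize:
  fixes p :: "(nat \<Rightarrow> real) \<Rightarrow> ennreal"
  assumes n: "n \<ge> 2" and p[measurable]: "p \<in> borel_measurable (lborel_n n)"
    and s: "sample_sd n x > 0"
  shows "ennreal (sample_sd n x ^ (n - 1)) *
      (\<integral>\<^sup>+(b, a). indicator {0<..} b * (ennreal (b ^ (n - 2)) * p (\<lambda>i\<in>{..<n}. a + b * x i))
         \<partial>(lborel \<Otimes>\<^sub>M lborel)) =
      (\<integral>\<^sup>+(b, a). indicator {0<..} b * (ennreal (b ^ (n - 2)) * p (\<lambda>i\<in>{..<n}. a + b * standardized n x i))
         \<partial>(lborel \<Otimes>\<^sub>M lborel))"
proof -
  let ?m = "sample_mean n x" and ?s = "sample_sd n x"
  let ?G = "\<lambda>b a. ennreal (b ^ (n - 2)) * p (\<lambda>i\<in>{..<n}. a + b * standardized n x i)"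
  have m[measurable]: "(\<lambda>(b, a). \<lambda>i\<in>{..<n}. a + b * y i) \<in> measurable (lborel \<Otimes>\<^sub>M lborel) (lborel_n n)"
    for y by measurable
  have "(\<integral>\<^sup>+(b, a). indicator {0<..} b * (ennreal (b ^ (n - 2)) * p (\<lambda>i\<in>{..<n}. a + b * x i))
         \<partial>(lborel \<Otimes>\<^sub>M lborel)) =
      ennreal (1 / ?s * 1) *
      (\<integral>\<^sup>+(b, a). indicator {0<..} b * (ennreal ((1 / ?s * b) ^ (n - 2)) *
         p (\<lambda>i\<in>{..<n}. (0 + 1 * a + (- ?m / ?s) * b) + 1 / ?s * b * x i)) \<partial>(lborel \<Otimes>\<^sub>M lborel))"
    \<comment> \<open>The map sends \<open>(b, a)\<close> to \<open>(b / s, a - b m / s)\<close>, whose action on \<open>x\<close> is that of \<open>(b, a)\<close> on the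
        standardized sample.\<close>
    using s by (intro nn_integral_half_plane_affine) auto
  also have "(\<integral>\<^sup>+(b, a). indicator {0<..} b * (ennreal ((1 / ?s * b) ^ (n - 2)) *
         p (\<lambda>i\<in>{..<n}. (0 + 1 * a + (- ?m / ?s) * b) + 1 / ?s * b * x i)) \<partial>(lborel \<Otimes>\<^sub>M lborel)) =
     (\<integral>\<^sup>+(b, a). ennreal ((1 / ?s) ^ (n - 2)) * (indicator {0<..} b * ?G b a) \<partial>(lborel \<Otimes>\<^sub>M lborel))"
  proof (intro nn_integral_cong, clarify)
    fix b a :: real
    have e: "(0 + 1 * a + (- ?m / ?s) * b) + 1 / ?s * b * x i = a + b * standardized n x i" for i
      by (simp add: standardized_def diff_divide_distrib algebra_simps)
    have "b > 0 \<Longrightarrow> ennreal ((1 / ?s * b) ^ (n - 2)) = ennreal ((1 / ?s) ^ (n - 2)) * ennreal (b ^ (n - 2))"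
      using s by (subst ennreal_mult[symmetric]) (auto simp: power_divide)
    then show "indicator {0<..} b * (ennreal ((1 / ?s * b) ^ (n - 2)) *
         p (\<lambda>i\<in>{..<n}. (0 + 1 * a + (- ?m / ?s) * b) + 1 / ?s * b * x i)) =
        ennreal ((1 / ?s) ^ (n - 2)) * (indicator {0<..} b * ?G b a)"
      unfolding e by (auto simp: indicator_def mult_ac simp del: times_divide_eq_left)
  qed
  also have "\<dots> = ennreal ((1 / ?s) ^ (n - 2)) * (\<integral>\<^sup>+(b, a). indicator {0<..} b * ?G b a \<partial>(lborel \<Otimes>\<^sub>M lborel))"
    by (subst nn_integral_cmult[symmetric]) (auto simp: case_prod_beta')
  finally have J: "(\<integral>\<^sup>+(b, a). indicator {0<..} b * (ennreal (b ^ (n - 2)) * p (\<lambda>i\<in>{..<n}. a + b * x i))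
         \<partial>(lborel \<Otimes>\<^sub>M lborel)) = ennreal (1 / ?s * 1) * (ennreal ((1 / ?s) ^ (n - 2)) *
      (\<integral>\<^sup>+(b, a). indicator {0<..} b * ?G b a \<partial>(lborel \<Otimes>\<^sub>M lborel)))" .
  have "?s ^ (n - 1) * (1 / ?s * 1 * (1 / ?s) ^ (n - 2)) = 1"
  proof -
    have "n - 1 = Suc (n - 2)" using n by simp
    then show ?thesis using s by (simp add: power_divide)
  qed
  then have "ennreal (?s ^ (n - 1)) * (ennreal (1 / ?s * 1) * ennreal ((1 / ?s) ^ (n - 2))) = 1"
    using s by (subst ennreal_mult[symmetric], simp, simp)+ simp
  then show ?thesis unfolding J by (simp add: mult.assoc[symmetric])
qed

lemma invariant_region_measurable:
  "invariant_region n R \<Longrightarrow> R \<in> sets (lborel_n n)"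
  by (simp add: invariant_region_def cong: sets_PiM_cong)

lemma invariant_region_affine:
  "invariant_region n R \<Longrightarrow> b > 0 \<Longrightarrow> x \<in> space (lborel_n n) \<Longrightarrow>
     (\<lambda>i\<in>{..<n}. a + b * x i) \<in> R \<longleftrightarrow> x \<in> R"
  by (simp add: invariant_region_def space_PiM)

text \<open>
  Averaging over the affine group turns the integral of \<open>p\<close> over an invariant region into an integral
  in which \<open>p\<close> enters only through its integrals along orbits. Start from the right-hand side, where the
  inner integral may be taken along the orbit of \<open>x\<close> itself by the preceding lemma. Exchange the
  integrals and, for fixed \<open>(a, b)\<close>, substitute \<open>y = a + b x\<close>; invariance keeps the region, and \<open>p\<close> is now
  evaluated at \<open>y\<close>. Exchange back: what remains along the orbit of \<open>y\<close> depends on \<open>y\<close> only through its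
  mean and standard deviation, and the substitution \<open>(a, b) \<mapsto> (m + s a, s b)\<close> shows that it is a
  constant. The function \<open>E\<close> is arbitrary, and the value of the constant is determined afterwards by
  inserting the normal density and the whole sample space.
\<close>

lemma nn_integral_invariant_region:
  fixes p :: "(nat \<Rightarrow> real) \<Rightarrow> ennreal" and E :: "real \<Rightarrow> real \<Rightarrow> ennreal"
  assumes n: "n \<ge> 2" and p[measurable]: "p \<in> borel_measurable (lborel_n n)"
    and E[measurable]: "(\<lambda>(m, s). E m s) \<in> borel_measurable (borel \<Otimes>\<^sub>M borel)"
    and R: "invariant_region n R"
  shows "(\<integral>\<^sup>+(b, a). indicator {0<..} b * (ennreal (1 / b ^ (n + 1)) * E (- a / b) (1 / b))
            \<partial>(lborel \<Otimes>\<^sub>M lborel)) * (\<integral>\<^sup>+x. indicator R x * p x \<partial>lborel_n n) =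
    (\<integral>\<^sup>+x. indicator R x * (E (sample_mean n x) (sample_sd n x) *
       (\<integral>\<^sup>+(b, a). indicator {0<..} b * (ennreal (b ^ (n - 2)) * p (\<lambda>i\<in>{..<n}. a + b * standardized n x i))
         \<partial>(lborel \<Otimes>\<^sub>M lborel))) \<partial>lborel_n n)" (is "?\<kappa> * _ = ?rhs")
proof -
  note R' = invariant_region_measurable[OF R, measurable]
  let ?L = "lborel_n n" and ?P = "lborel \<Otimes>\<^sub>M lborel :: (real \<times> real) measure"
  let ?m = "sample_mean n" and ?s = "sample_sd n"
  interpret LP: product_sigma_finite "\<lambda>_::nat. lborel :: real measure" by standard
  have "sigma_finite_measure ?L" by (rule LP.sigma_finite) simp
  then interpret LL: pair_sigma_finite ?L ?P
    by (simp add: pair_sigma_finite_def lborel_pair.sigma_finite_measure_axioms)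
  have m[measurable]: "(\<lambda>(x, (b, a)). \<lambda>i\<in>{..<n}. a + b * x i) \<in> measurable (?L \<Otimes>\<^sub>M ?P) ?L"
    by (subst case_prod_beta', subst case_prod_beta', measurable)
  have m2[measurable]: "(\<lambda>x. \<lambda>i\<in>{..<n}. a + b * x i) \<in> measurable ?L ?L" for a b
    by measurable
  have mp[measurable]: "(\<lambda>q. p (\<lambda>i\<in>{..<n}. snd (snd q) + fst (snd q) * fst q i)) \<in> borel_measurable (?L \<Otimes>\<^sub>M ?P)"
    using measurable_compose[OF m p] by (simp add: case_prod_beta')
  have mpx[measurable]: "(\<lambda>q. p (\<lambda>i\<in>{..<n}. snd q + fst q * x i)) \<in> borel_measurable ?P" for x
    by (rule measurable_compose[OF _ p]) measurable
  have mE[measurable]: "(\<lambda>x. E (u x) (v x)) \<in> borel_measurable M"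
    if "u \<in> borel_measurable M" "v \<in> borel_measurable M" for M :: "'b measure" and u v
    using measurable_compose[OF measurable_Pair[OF that] E] by simp
  \<comment> \<open>The substitution \<open>y = a + b x\<close>: the factor \<open>b ^ (n - 2)\<close> and the Jacobian \<open>b ^ (- n)\<close> leave \<open>1 / b\<^sup>2\<close>.\<close>
  have step: "(\<integral>\<^sup>+x. indicator {0<..} b * (ennreal (b ^ (n - 2)) * (indicator R x *
        (E (?m x) (?s x) * (ennreal (?s x ^ (n - 1)) * p (\<lambda>i\<in>{..<n}. a + b * x i))))) \<partial>?L) =
      (\<integral>\<^sup>+y. indicator R y * (p y * (indicator {0<..} b * (ennreal (1 / b\<^sup>2) *
        (E ((?m y - a) / b) (?s y / b) * ennreal ((?s y / b) ^ (n - 1)))))) \<partial>?L)" (is "?l = ?r") for a b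
  proof (cases "b > 0")
    case b: True
    define H where "H y = indicator R y * (E ((?m y - a) / b) (?s y / b) *
        (ennreal ((?s y / b) ^ (n - 1)) * p y))" for y
    have [measurable]: "H \<in> borel_measurable ?L" unfolding H_def by measurable
    have "(\<integral>\<^sup>+x. indicator R x * (E (?m x) (?s x) * (ennreal (?s x ^ (n - 1)) *
        p (\<lambda>i\<in>{..<n}. a + b * x i))) \<partial>?L) = (\<integral>\<^sup>+x. H (\<lambda>i\<in>{..<n}. a + b * x i) \<partial>?L)"
      using n b by (intro nn_integral_cong)
        (simp add: H_def sample_mean_affine sample_sd_affine invariant_region_affine[OF R] indicator_def)
    then have "?l = ennreal (b ^ (n - 2)) * (\<integral>\<^sup>+x. H (\<lambda>i\<in>{..<n}. a + b * x i) \<partial>?L)"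
      using b by (simp add: nn_integral_cmult)
    also have "\<dots> = ennreal (1 / b\<^sup>2) * (ennreal (b ^ n) * (\<integral>\<^sup>+x. H (\<lambda>i\<in>{..<n}. a + b * x i) \<partial>?L))"
    proof -
      have "b ^ n = b ^ (n - 2) * b\<^sup>2" using n by (metis le_add_diff_inverse2 power_add)
      then have "1 / b\<^sup>2 * b ^ n = b ^ (n - 2)" using b by simp
      then have "ennreal (b ^ (n - 2)) = ennreal (1 / b\<^sup>2) * ennreal (b ^ n)"
        using b by (subst ennreal_mult[symmetric]) auto
      then show ?thesis by (simp only: mult.assoc)
    qed
    also have "ennreal (b ^ n) * (\<integral>\<^sup>+x. H (\<lambda>i\<in>{..<n}. a + b * x i) \<partial>?L) = (\<integral>\<^sup>+y. H y \<partial>?L)"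
      using nn_integral_PiM_lborel_affine[of "{..<n}" b H a] b by simp
    also have "ennreal (1 / b\<^sup>2) * \<dots> = ?r"
      using b by (subst nn_integral_cmult[symmetric]) (auto simp: H_def mult_ac intro!: nn_integral_cong)
    finally show ?thesis .
  qed simp
  have "?rhs = (\<integral>\<^sup>+x. indicator R x * (E (?m x) (?s x) * (ennreal (?s x ^ (n - 1)) *
     (\<integral>\<^sup>+(b, a). indicator {0<..} b * (ennreal (b ^ (n - 2)) * p (\<lambda>i\<in>{..<n}. a + b * x i)) \<partial>?P))) \<partial>?L)"
    by (intro nn_integral_cong_AE, use AE_sample_sd_pos[OF n] in eventually_elim)
       (simp only: orbit_integral_standardize[OF n p])
  also have "\<dots> = (\<integral>\<^sup>+x. (\<integral>\<^sup>+q. indicator {0<..} (fst q) * (ennreal (fst q ^ (n - 2)) * (indicator R x *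
      (E (?m x) (?s x) * (ennreal (?s x ^ (n - 1)) * p (\<lambda>i\<in>{..<n}. snd q + fst q * x i))))) \<partial>?P) \<partial>?L)"
    by (intro nn_integral_cong)
       (simp add: nn_integral_cmult[symmetric] case_prod_beta' mult_ac)
  also have "\<dots> = (\<integral>\<^sup>+q. (\<integral>\<^sup>+x. indicator {0<..} (fst q) * (ennreal (fst q ^ (n - 2)) * (indicator R x *
      (E (?m x) (?s x) * (ennreal (?s x ^ (n - 1)) * p (\<lambda>i\<in>{..<n}. snd q + fst q * x i))))) \<partial>?L) \<partial>?P)"
    by (rule LL.Fubini'[symmetric]) measurable
  also have "\<dots> = (\<integral>\<^sup>+q. (\<integral>\<^sup>+y. indicator R y * (p y * (indicator {0<..} (fst q) * (ennreal (1 / (fst q)\<^sup>2) *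
        (E ((?m y - snd q) / fst q) (?s y / fst q) * ennreal ((?s y / fst q) ^ (n - 1)))))) \<partial>?L) \<partial>?P)"
    by (simp only: step)
  also have "\<dots> = (\<integral>\<^sup>+y. (\<integral>\<^sup>+q. indicator R y * (p y * (indicator {0<..} (fst q) * (ennreal (1 / (fst q)\<^sup>2) *
        (E ((?m y - snd q) / fst q) (?s y / fst q) * ennreal ((?s y / fst q) ^ (n - 1)))))) \<partial>?P) \<partial>?L)"
    by (rule LL.Fubini') measurable
  also have "\<dots> = (\<integral>\<^sup>+y. indicator R y * (p y * (\<integral>\<^sup>+q. indicator {0<..} (fst q) * (ennreal (1 / (fst q)\<^sup>2) *
        (E ((?m y - snd q) / fst q) (?s y / fst q) * ennreal ((?s y / fst q) ^ (n - 1)))) \<partial>?P)) \<partial>?L)"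
    by (simp add: nn_integral_cmult)
  also have "\<dots> = (\<integral>\<^sup>+y. indicator R y * (p y * ?\<kappa>) \<partial>?L)"
  proof (intro nn_integral_cong_AE, use AE_sample_sd_pos[OF n] in eventually_elim)
    fix y assume s: "?s y > 0"
    let ?K = "\<lambda>b a. ennreal (1 / b\<^sup>2) * (E ((?m y - a) / b) (?s y / b) * ennreal ((?s y / b) ^ (n - 1)))"
    have "(\<integral>\<^sup>+q. indicator {0<..} (fst q) * (ennreal (1 / (fst q)\<^sup>2) *
        (E ((?m y - snd q) / fst q) (?s y / fst q) * ennreal ((?s y / fst q) ^ (n - 1)))) \<partial>?P) =
      (\<integral>\<^sup>+(b, a). indicator {0<..} b * ?K b a \<partial>?P)" by (simp add: case_prod_beta')
    also have "\<dots> = ennreal (?s y * ?s y) * (\<integral>\<^sup>+(b, a). indicator {0<..} b *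
        ?K (?s y * b) (?m y + ?s y * a + 0 * b) \<partial>?P)"
      using s by (intro nn_integral_half_plane_affine) auto
    also have "\<dots> = (\<integral>\<^sup>+(b, a). ennreal (?s y * ?s y) * (indicator {0<..} b *
        ?K (?s y * b) (?m y + ?s y * a + 0 * b)) \<partial>?P)"
      by (subst nn_integral_cmult[symmetric]) (auto simp: case_prod_beta')
    also have "\<dots> = ?\<kappa>"
    proof (intro nn_integral_cong, clarify)
      fix b a :: real
      show "ennreal (?s y * ?s y) * (indicator {0<..} b * ?K (?s y * b) (?m y + ?s y * a + 0 * b)) =
        indicator {0<..} b * (ennreal (1 / b ^ (n + 1)) * E (- a / b) (1 / b))"
      proof (cases "b > 0")
        case b: True
        have e: "(?m y - (?m y + ?s y * a + 0 * b)) / (?s y * b) = - a / b" "?s y / (?s y * b) = 1 / b"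
          using s by auto
        have "n + 1 = 2 + (n - 1)" using n by simp
        then have "b ^ (n + 1) = b\<^sup>2 * b ^ (n - 1)" by (metis power_add)
        then have "?s y * ?s y * (1 / (?s y * b)\<^sup>2) * (1 / b) ^ (n - 1) = 1 / b ^ (n + 1)"
          using s b by (simp add: power_divide power2_eq_square)
        then have "ennreal (1 / b ^ (n + 1)) =
           ennreal (?s y * ?s y) * ennreal (1 / (?s y * b)\<^sup>2) * ennreal ((1 / b) ^ (n - 1))"
          using s b by ((subst ennreal_mult[symmetric], simp, simp)+) simp
        then show ?thesis using b by (simp add: e mult_ac)
      qed simp
    qed
    finally show "indicator R y * (p y * (\<integral>\<^sup>+q. indicator {0<..} (fst q) * (ennreal (1 / (fst q)\<^sup>2) *
        (E ((?m y - snd q) / fst q) (?s y / fst q) * ennreal ((?s y / fst q) ^ (n - 1)))) \<partial>?P)) =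
      indicator R y * (p y * ?\<kappa>)" by simp
  qed
  also have "\<dots> = ?\<kappa> * (\<integral>\<^sup>+y. indicator R y * p y \<partial>?L)"
    by (subst nn_integral_cmult[symmetric]) (auto simp: mult_ac)
  finally show ?thesis by simp
qed


section \<open>The Gaussian weight on the orbits\<close>

definition orbit_weight :: "nat \<Rightarrow> real \<times> real \<Rightarrow> real" where
  "orbit_weight n q = indicator {0<..} (fst q) *
     (exp (- (real n * ((snd q)\<^sup>2 + (fst q)\<^sup>2) / 2)) * fst q ^ (n - 2))"

definition orbit_measure :: "nat \<Rightarrow> (real \<times> real) measure" where
  "orbit_measure n = density (lborel \<Otimes>\<^sub>M lborel) (\<lambda>q. ennreal (orbit_weight n q))"

lemma measurable_orbit_weight [measurable]:
  "orbit_weight n \<in> borel_measurable (lborel \<Otimes>\<^sub>M lborel)"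
  unfolding orbit_weight_def by measurable

lemma orbit_weight_nonneg: "orbit_weight n q \<ge> 0"
  by (auto simp: orbit_weight_def indicator_def)

lemma orbit_weight_pos_iff: "orbit_weight n q > 0 \<longleftrightarrow> fst q > 0"
  by (auto simp: orbit_weight_def indicator_def)

lemma sets_orbit_measure [simp, measurable_cong]:
  "sets (orbit_measure n) = sets (lborel \<Otimes>\<^sub>M lborel)"
  by (simp add: orbit_measure_def)

lemma space_orbit_measure [simp]: "space (orbit_measure n) = UNIV"
  by (simp add: orbit_measure_def space_pair_measure)

lemma AE_orbit_measure_pos: "AE q in orbit_measure n. fst q > 0"
  unfolding orbit_measure_def by (subst AE_density) (auto simp: orbit_weight_pos_iff)

lemma nn_integral_orbit_measure:
  "g \<in> borel_measurable (lborel \<Otimes>\<^sub>M lborel) \<Longrightarrow>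
    (\<integral>\<^sup>+q. g q \<partial>orbit_measure n) = (\<integral>\<^sup>+q. ennreal (orbit_weight n q) * g q \<partial>(lborel \<Otimes>\<^sub>M lborel))"
  unfolding orbit_measure_def by (rule nn_integral_density) auto

lemma emeasure_orbit_measure_UNIV:
  "emeasure (orbit_measure n) UNIV = (\<integral>\<^sup>+q. ennreal (orbit_weight n q) \<partial>(lborel \<Otimes>\<^sub>M lborel))"
  using nn_integral_orbit_measure[of "\<lambda>_. 1" n] by simp

lemma nn_integral_gaussian_moment_finite:
  assumes n: "n > 0"
  shows "(\<integral>\<^sup>+x. ennreal (exp (- (real n * x\<^sup>2 / 2)) * \<bar>x\<bar> ^ k) \<partial>lborel) < \<infinity>"
proof -
  have "integrable lborel (\<lambda>x. sqrt (2 * pi / n) * (normal_density 0 (1 / sqrt n) x * \<bar>x - 0\<bar> ^ k))"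
    using n by (intro integrable_mult_right integrable_normal_moment_abs) auto
  also have "(\<lambda>x. sqrt (2 * pi / n) * (normal_density 0 (1 / sqrt n) x * \<bar>x - 0\<bar> ^ k)) =
      (\<lambda>x. exp (- (real n * x\<^sup>2 / 2)) * \<bar>x\<bar> ^ k)"
    using n by (simp add: normal_density_def fun_eq_iff power_divide field_simps real_sqrt_divide real_sqrt_mult)
  finally show ?thesis
    by (simp add: integrable_iff_bounded abs_mult)
qed

lemma finite_measure_orbit_measure:
  assumes n: "n > 0"
  shows "finite_measure (orbit_measure n)"
proof
  let ?h = "\<lambda>k x. ennreal (exp (- (real n * x\<^sup>2 / 2)) * \<bar>x\<bar> ^ k)"
  have "emeasure (orbit_measure n) (space (orbit_measure n)) =
      (\<integral>\<^sup>+q. ennreal (orbit_weight n q) \<partial>(lborel \<Otimes>\<^sub>M lborel))"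
    by (simp add: emeasure_orbit_measure_UNIV)
  also have "\<dots> \<le> (\<integral>\<^sup>+q. ?h (n - 2) (fst q) * ?h 0 (snd q) \<partial>(lborel \<Otimes>\<^sub>M lborel))"
  proof (rule nn_integral_mono)
    fix q :: "real \<times> real"
    have "exp (- (real n * ((snd q)\<^sup>2 + (fst q)\<^sup>2) / 2)) =
        exp (- (real n * (fst q)\<^sup>2 / 2)) * exp (- (real n * (snd q)\<^sup>2 / 2))"
      by (simp add: exp_add[symmetric] algebra_simps add_divide_distrib)
    then show "ennreal (orbit_weight n q) \<le> ?h (n - 2) (fst q) * ?h 0 (snd q)"
      by (subst ennreal_mult[symmetric])
         (auto simp: orbit_weight_def indicator_def mult_ac)
  qed
  also have "\<dots> = (\<integral>\<^sup>+b. (\<integral>\<^sup>+a. ?h (n - 2) b * ?h 0 a \<partial>lborel) \<partial>lborel)"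
    by (subst lborel.nn_integral_fst[symmetric]) auto
  also have "\<dots> = (\<integral>\<^sup>+b. ?h (n - 2) b \<partial>lborel) * (\<integral>\<^sup>+a. ?h 0 a \<partial>lborel)"
    by (simp add: nn_integral_cmult nn_integral_multc)
  also have "\<dots> < \<infinity>"
    using nn_integral_gaussian_moment_finite[OF n, of "n - 2"] nn_integral_gaussian_moment_finite[OF n, of 0]
    by (simp add: ennreal_mult_less_top)
  finally show "emeasure (orbit_measure n) (space (orbit_measure n)) \<noteq> \<infinity>" by auto
qed

lemma measure_orbit_measure_pos:
  assumes n: "n > 0"
  shows "measure (orbit_measure n) UNIV > 0"
proof -
  interpret finite_measure "orbit_measure n" by (rule finite_measure_orbit_measure[OF n])
  have "emeasure (orbit_measure n) UNIV \<noteq> 0"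
  proof
    assume "emeasure (orbit_measure n) UNIV = 0"
    then have "(\<integral>\<^sup>+q. ennreal (orbit_weight n q) \<partial>(lborel \<Otimes>\<^sub>M lborel)) = 0"
      by (simp add: emeasure_orbit_measure_UNIV)
    then have "AE q in lborel \<Otimes>\<^sub>M lborel. ennreal (orbit_weight n q) = 0"
      by (simp add: nn_integral_0_iff_AE)
    then have "AE q in (lborel \<Otimes>\<^sub>M lborel :: (real \<times> real) measure). q \<notin> {0<..} \<times> UNIV"
      by eventually_elim (auto simp: ennreal_eq_0_iff orbit_weight_pos_iff simp flip: not_less)
    then have "emeasure (lborel \<Otimes>\<^sub>M lborel) ({0 :: real<..} \<times> (UNIV :: real set)) = 0"
      by (subst (asm) AE_iff_measurable[where N="{0<..} \<times> UNIV"]) (auto simp: space_pair_measure)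
    moreover have "emeasure lborel {0 :: real<..1} \<le> emeasure lborel {0 :: real<..}"
      by (intro emeasure_mono) auto
    ultimately show False
      by (subst (asm) lborel.emeasure_pair_measure_Times) auto
  qed
  then show ?thesis by (simp add: emeasure_eq_measure zero_less_measure_iff)
qed

section \<open>Inequalities for products of likelihood ratios\<close>

lemma abs_prod_minus_one_le:
  fixes r :: "nat \<Rightarrow> real"
  assumes "u \<ge> 0" "\<And>i. i < m \<Longrightarrow> \<bar>r i - 1\<bar> \<le> u"
  shows "\<bar>(\<Prod>i<m. r i) - 1\<bar> \<le> (1 + u) ^ m - 1"
  using assms(2)
proof (induction m)
  case (Suc m)
  let ?P = "\<Prod>i<m. r i"
  have IH: "\<bar>?P - 1\<bar> \<le> (1 + u) ^ m - 1" using Suc by simp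
  have r: "\<bar>r m - 1\<bar> \<le> u" using Suc by simp
  have "\<bar>?P * r m - 1\<bar> = \<bar>(?P - 1) * r m + (r m - 1)\<bar>" by (simp add: algebra_simps)
  also have "\<dots> \<le> \<bar>?P - 1\<bar> * \<bar>r m\<bar> + \<bar>r m - 1\<bar>"
    using abs_triangle_ineq[of "(?P - 1) * r m" "r m - 1"] by (simp add: abs_mult)
  also have "\<dots> \<le> ((1 + u) ^ m - 1) * (1 + u) + u"
    using IH r assms(1) by (intro add_mono mult_mono) auto
  finally show ?case by (simp add: algebra_simps)
qed simp

text \<open>
  The convex function \<open>t \<mapsto> (1 + t v)^m\<close> lies below its chord on \<open>[0, 1]\<close>. With \<open>t = \<theta> / \<epsilon>\<close> this bounds a
  difference quotient at \<open>\<theta>\<close> by the one at \<open>\<epsilon>\<close>, without raising the exponent \<open>m\<close>.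
\<close>

lemma power_one_plus_chord_le:
  fixes t v :: real
  assumes "0 \<le> t" "t \<le> 1" "0 \<le> v"
  shows "(1 + t * v) ^ m \<le> 1 + t * ((1 + v) ^ m - 1)"
proof (induction m)
  case (Suc m)
  define A where "A = (1 + v) ^ m - 1"
  have A: "A \<ge> 0" using assms by (simp add: A_def)
  have "t * t * (v * A) \<le> 1 * t * (v * A)" using assms A by (intro mult_right_mono) auto
  moreover have "(1 + t * v) * (1 + t * v) ^ m \<le> (1 + t * v) * (1 + t * A)"
    using Suc assms by (intro mult_left_mono) (auto simp: A_def)
  moreover have "(1 + v) * (1 + v) ^ m = (1 + v) * (1 + A)" by (simp add: A_def)
  ultimately show ?case by (simp add: algebra_simps)
qed simp

lemma power_one_plus_le:
  fixes u :: real
  assumes "u \<ge> 0"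
  shows "(1 + u) ^ m \<le> 2 ^ m * (1 + u ^ m)"
proof (cases "u \<le> 1")
  case True
  then have "(1 + u) ^ m \<le> 2 ^ m" using assms by (intro power_mono) auto
  also have "\<dots> \<le> 2 ^ m * (1 + u ^ m)" using assms by simp
  finally show ?thesis .
next
  case False
  then have "(1 + u) ^ m \<le> (2 * u) ^ m" by (intro power_mono) auto
  also have "\<dots> \<le> 2 ^ m * (1 + u ^ m)" by (simp add: power_mult_distrib)
  finally show ?thesis .
qed

section \<open>The power as an orbit average of the likelihood ratio\<close>

locale normal_alternative =
  fixes f :: "real \<Rightarrow> real \<Rightarrow> real" and n :: nat and \<epsilon> :: real
  assumes n_ge_3: "n \<ge> 3"
    and density_measurable: "\<And>\<theta>. \<theta> \<ge> 0 \<Longrightarrow> (\<lambda>x. f x \<theta>) \<in> borel_measurable borel"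
    and density_integral: "\<And>\<theta>. \<theta> \<ge> 0 \<Longrightarrow> (\<integral>\<^sup>+ x. ennreal (f x \<theta>) \<partial>lborel) = 1"
    and density_pos: "\<And>x \<theta>. \<theta> \<ge> 0 \<Longrightarrow> f x \<theta> > 0"
    and normal: "\<And>x. f x 0 = 1 / sqrt (2 * pi) * exp (- (x\<^sup>2 / 2))"
    and log_differentiable:
      "\<And>x \<theta>. \<theta> \<ge> 0 \<Longrightarrow> (\<lambda>t. ln (f x t)) differentiable (at \<theta> within {0..})"
    and eps_pos: "\<epsilon> > 0"
    and integrability:
      "(\<integral>\<^sup>+ b \<in> {0<..}. (\<integral>\<^sup>+ a. g_bound f n a b \<epsilon> ^ n *
          ennreal (exp (- (real n * (a\<^sup>2 + b\<^sup>2) / 2)) * b ^ (n - 2)) \<partial>lborel) \<partial>lborel) < \<infinity>"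
begin

abbreviation P :: "real \<Rightarrow> (nat \<Rightarrow> real) measure" where
  "P \<theta> \<equiv> sample_law f n 0 1 \<theta>"

abbreviation \<mu> :: "(real \<times> real) measure" where
  "\<mu> \<equiv> orbit_measure n"

definition ratio_integrand :: "real \<Rightarrow> (nat \<Rightarrow> real) \<Rightarrow> real \<times> real \<Rightarrow> real" where
  "ratio_integrand \<theta> x q =
     (\<Prod>i<n. f (snd q + fst q * standardized n x i) \<theta> / f (snd q + fst q * standardized n x i) 0)"

definition score_integrand :: "(nat \<Rightarrow> real) \<Rightarrow> real \<times> real \<Rightarrow> real" where
  "score_integrand x q = (\<Sum>i<n. l_theta f (snd q + fst q * standardized n x i) 0)"

definition total_weight :: real where
  "total_weight = measure \<mu> UNIV"

lemma n_pos: "n > 0" and n_ge_2: "n \<ge> 2"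
  using n_ge_3 by auto

sublocale \<mu>: finite_measure \<mu>
  by (rule finite_measure_orbit_measure[OF n_pos])

lemma total_weight_pos: "total_weight > 0"
  unfolding total_weight_def by (rule measure_orbit_measure_pos[OF n_pos])

lemma emeasure_\<mu>: "emeasure \<mu> UNIV = ennreal total_weight"
  by (simp add: total_weight_def \<mu>.emeasure_eq_measure)

lemma measurable_ratio_integrand_pair [measurable]:
  assumes "\<theta> \<ge> 0"
  shows "(\<lambda>(x, q). ratio_integrand \<theta> x q) \<in> borel_measurable (lborel_n n \<Otimes>\<^sub>M (lborel \<Otimes>\<^sub>M lborel))"
proof -
  note density_measurable[OF assms, measurable] density_measurable[OF order_refl, measurable]
  show ?thesis
    unfolding ratio_integrand_def by measurable
qed

lemma measurable_ratio_integrand [measurable]: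
  assumes "\<theta> \<ge> 0"
  shows "ratio_integrand \<theta> x \<in> borel_measurable (lborel \<Otimes>\<^sub>M lborel)"
proof -
  note density_measurable[OF assms, measurable] density_measurable[OF order_refl, measurable]
  show ?thesis
    unfolding ratio_integrand_def by measurable
qed

lemma ratio_integrand_pos: "\<theta> \<ge> 0 \<Longrightarrow> ratio_integrand \<theta> x q > 0"
  by (simp add: ratio_integrand_def prod_pos density_pos)

lemma ratio_integrand_0: "ratio_integrand 0 x q = 1"
proof -
  have "f y 0 \<noteq> 0" for y using density_pos[of 0 y] by simp
  then show ?thesis by (simp add: ratio_integrand_def)
qed

lemma prob_space_density:
  assumes "\<theta> \<ge> 0" shows "prob_space (density lborel (\<lambda>x. ennreal (f x \<theta>)))"
proof -
  note density_measurable[OF assms, measurable]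
  show ?thesis
    using density_integral[OF assms] by (intro prob_spaceI) (simp add: emeasure_density)
qed

lemma sample_law_eq_density:
  assumes "\<theta> \<ge> 0"
  shows "P \<theta> = density (lborel_n n) (\<lambda>x. ennreal (\<Prod>i<n. f (x i) \<theta>))"
proof -
  note density_measurable[OF assms, measurable]
  interpret prob_space "density lborel (\<lambda>x. ennreal (f x \<theta>))" by (rule prob_space_density[OF assms])
  have "P \<theta> = (\<Pi>\<^sub>M i\<in>{..<n}. density lborel (\<lambda>x. ennreal (f x \<theta>)))"
    by (simp add: sample_law_def loc_scale_def)
  also have "\<dots> = density (lborel_n n) (\<lambda>x. \<Prod>i<n. ennreal (f (x i) \<theta>))"
    by (rule density_PiM) (auto intro: sigma_finite_measure_axioms lborel.sigma_finite_measure_axioms)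
  also have "\<dots> = density (lborel_n n) (\<lambda>x. ennreal (\<Prod>i<n. f (x i) \<theta>))"
    using density_pos[OF assms] by (intro density_cong) (auto simp: prod_ennreal less_imp_le)
  finally show ?thesis .
qed

lemma prob_space_P: "\<theta> \<ge> 0 \<Longrightarrow> prob_space (P \<theta>)"
  unfolding sample_law_def loc_scale_def using prob_space_density[of \<theta>]
  by (intro prob_space_PiM) simp

sublocale P0: prob_space "P 0"
  by (rule prob_space_P) simp

lemma sets_P [simp, measurable_cong]: "sets (P \<theta>) = sets (lborel_n n)"
  unfolding sample_law_def by (intro sets_PiM_cong) auto

lemma space_P: "space (P \<theta>) = space (lborel_n n)"
  by (rule sets_eq_imp_space_eq) simp

lemma measurable_joint_density [measurable]:
  assumes "\<theta> \<ge> 0"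
  shows "(\<lambda>x. \<Prod>i<n. f (x i) \<theta>) \<in> borel_measurable (lborel_n n)"
proof -
  note density_measurable[OF assms, measurable]
  show ?thesis by measurable
qed

text \<open>
  The densities are strictly positive, so all the laws have the null sets of Lebesgue measure.
\<close>

lemma AE_P_iff:
  assumes "\<theta> \<ge> 0"
  shows "(AE x in P \<theta>. Q x) \<longleftrightarrow> (AE x in lborel_n n. Q x)"
proof -
  have "(\<Prod>i<n. f (x i) \<theta>) > 0" for x using density_pos[OF assms] by (simp add: prod_pos)
  then show ?thesis
    unfolding sample_law_eq_density[OF assms] using measurable_joint_density[OF assms]
    by (subst AE_density) auto
qed

lemma AE_P0_sample_sd_pos: "AE x in P 0. sample_sd n x > 0"
  using AE_sample_sd_pos[OF n_ge_2] by (simp add: AE_P_iff)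

lemma joint_normal_density:
  "(\<Prod>i<n. f (y i) 0) = (1 / sqrt (2 * pi)) ^ n * exp (- ((\<Sum>i<n. (y i)\<^sup>2) / 2))"
  by (simp add: normal prod.distrib prod_constant exp_sum[symmetric] sum_negf sum_divide_distrib
      del: times_divide_eq_left)

text \<open>
  Dividing and multiplying by the normal density on the orbit produces the likelihood ratio and the
  Gaussian weight.
\<close>

lemma nn_integral_ratio_integrand:
  assumes \<theta>: "\<theta> \<ge> 0" and s: "sample_sd n x > 0"
  shows "(\<integral>\<^sup>+(b, a). indicator {0<..} b * (ennreal (b ^ (n - 2)) *
           ennreal (\<Prod>i<n. f ((\<lambda>i\<in>{..<n}. a + b * standardized n x i) i) \<theta>)) \<partial>(lborel \<Otimes>\<^sub>M lborel)) =
         ennreal ((1 / sqrt (2 * pi)) ^ n) * (\<integral>\<^sup>+q. ennreal (ratio_integrand \<theta> x q) \<partial>\<mu>)"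
proof -
  note measurable_ratio_integrand[OF \<theta>, measurable]
  have "(\<integral>\<^sup>+(b, a). indicator {0<..} b * (ennreal (b ^ (n - 2)) *
           ennreal (\<Prod>i<n. f ((\<lambda>i\<in>{..<n}. a + b * standardized n x i) i) \<theta>)) \<partial>(lborel \<Otimes>\<^sub>M lborel)) =
     (\<integral>\<^sup>+q. ennreal ((1 / sqrt (2 * pi)) ^ n) * (ennreal (orbit_weight n q) * ennreal (ratio_integrand \<theta> x q))
        \<partial>(lborel \<Otimes>\<^sub>M lborel))"
  proof (intro nn_integral_cong, clarify)
    fix b a :: real
    have nz: "f y 0 \<noteq> 0" for y using density_pos[of 0 y] by simp
    have "(\<Prod>i<n. f (a + b * standardized n x i) \<theta>) =
       ratio_integrand \<theta> x (b, a) * (\<Prod>i<n. f (a + b * standardized n x i) 0)"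
      by (simp add: ratio_integrand_def nz flip: prod.distrib)
    also have "\<dots> = ratio_integrand \<theta> x (b, a) *
        ((1 / sqrt (2 * pi)) ^ n * exp (- (real n * (a\<^sup>2 + b\<^sup>2) / 2)))"
      by (simp only: joint_normal_density sum_power2_affine_standardized[OF n_pos s])
    finally have e: "(\<Prod>i<n. f (a + b * standardized n x i) \<theta>) = \<dots>" .
    show "indicator {0<..} b * (ennreal (b ^ (n - 2)) *
           ennreal (\<Prod>i<n. f ((\<lambda>i\<in>{..<n}. a + b * standardized n x i) i) \<theta>)) =
      ennreal ((1 / sqrt (2 * pi)) ^ n) * (ennreal (orbit_weight n (b, a)) * ennreal (ratio_integrand \<theta> x (b, a)))"
    proof (cases "b > 0")
      case b: True
      have "ennreal ((1 / sqrt (2 * pi)) ^ n) * (ennreal (orbit_weight n (b, a)) * ennreal (ratio_integrand \<theta> x (b, a))) =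
        ennreal ((1 / sqrt (2 * pi)) ^ n * (orbit_weight n (b, a) * ratio_integrand \<theta> x (b, a)))"
        using ratio_integrand_pos[OF \<theta>] orbit_weight_nonneg by (simp add: ennreal_mult less_imp_le)
      also have "\<dots> = ennreal (b ^ (n - 2) * (\<Prod>i<n. f (a + b * standardized n x i) \<theta>))"
        unfolding e using b by (intro arg_cong[where f=ennreal]) (simp add: orbit_weight_def)
      also have "\<dots> = ennreal (b ^ (n - 2)) * ennreal (\<Prod>i<n. f (a + b * standardized n x i) \<theta>)"
        using b density_pos[OF \<theta>] by (simp add: ennreal_mult prod_nonneg less_imp_le)
      finally show ?thesis using b by simp
    qed (simp add: orbit_weight_def)
  qed
  also have "\<dots> = ennreal ((1 / sqrt (2 * pi)) ^ n) * (\<integral>\<^sup>+q. ennreal (ratio_integrand \<theta> x q) \<partial>\<mu>)"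
    by (subst nn_integral_orbit_measure) (auto simp: nn_integral_cmult)
  finally show ?thesis .
qed

text \<open>
  The formula of the group average for the two densities \<open>\<theta>\<close> and 0, with \<open>E\<close> chosen such that
  \<open>E (mean) (sd)\<close> is the joint normal density. The unknown constant \<open>\<kappa>\<close> is found by taking
  \<open>\<theta> = 0\<close> and the whole space as region.
\<close>

lemma emeasure_P_eq_ratio_integral:
  assumes \<theta>: "\<theta> \<ge> 0" and R: "invariant_region n R"
  shows "ennreal total_weight * emeasure (P \<theta>) R =
     (\<integral>\<^sup>+x. indicator R x * (\<integral>\<^sup>+q. ennreal (ratio_integrand \<theta> x q) \<partial>\<mu>) \<partial>P 0)"
proof -
  define c where "c = (1 / sqrt (2 * pi)) ^ n"
  have c: "c > 0" by (simp add: c_def)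
  define E where "E m s = ennreal (c * exp (- (real n * (m\<^sup>2 + s\<^sup>2) / 2)))" for m s
  have E[measurable]: "(\<lambda>(m, s). E m s) \<in> borel_measurable (borel \<Otimes>\<^sub>M borel)"
    unfolding E_def by measurable
  define \<kappa> where "\<kappa> = (\<integral>\<^sup>+(b, a). indicator {0<..} b * (ennreal (1 / b ^ (n + 1)) * E (- a / b) (1 / b))
            \<partial>(lborel \<Otimes>\<^sub>M lborel))"
  have E_eq: "E (sample_mean n x) (sample_sd n x) = ennreal (\<Prod>i<n. f (x i) 0)" for x
    using sum_power2_affine_sample[OF n_pos, of 0 1 x] by (simp add: E_def joint_normal_density c_def)
  have main: "\<kappa> * emeasure (P \<theta>) R =
     ennreal c * (\<integral>\<^sup>+x. indicator R x * (\<integral>\<^sup>+q. ennreal (ratio_integrand \<theta> x q) \<partial>\<mu>) \<partial>P 0)"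
    if \<theta>: "\<theta> \<ge> 0" and R: "invariant_region n R" for \<theta> R
  proof -
    note invariant_region_measurable[OF R, measurable]
    note measurable_ratio_integrand_pair[OF \<theta>, measurable]
    note measurable_joint_density[OF \<theta>, measurable] measurable_joint_density[OF order_refl, measurable]
    have [measurable]: "(\<lambda>x. \<integral>\<^sup>+q. ennreal (ratio_integrand \<theta> x q) \<partial>\<mu>) \<in> borel_measurable (lborel_n n)"
      by measurable
    have "\<kappa> * emeasure (P \<theta>) R = \<kappa> * (\<integral>\<^sup>+x. indicator R x * ennreal (\<Prod>i<n. f (x i) \<theta>) \<partial>lborel_n n)"
      using \<theta> by (simp add: sample_law_eq_density emeasure_density mult.commute)
    also have "\<dots> = (\<integral>\<^sup>+x. indicator R x * (E (sample_mean n x) (sample_sd n x) *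
       (\<integral>\<^sup>+(b, a). indicator {0<..} b * (ennreal (b ^ (n - 2)) *
          ennreal (\<Prod>i<n. f ((\<lambda>i\<in>{..<n}. a + b * standardized n x i) i) \<theta>))
         \<partial>(lborel \<Otimes>\<^sub>M lborel))) \<partial>lborel_n n)"
      unfolding \<kappa>_def by (rule nn_integral_invariant_region[OF n_ge_2 _ E R]) measurable
    also have "\<dots> = (\<integral>\<^sup>+x. ennreal c * (ennreal (\<Prod>i<n. f (x i) 0) *
       (indicator R x * (\<integral>\<^sup>+q. ennreal (ratio_integrand \<theta> x q) \<partial>\<mu>))) \<partial>lborel_n n)"
      by (intro nn_integral_cong_AE, use AE_sample_sd_pos[OF n_ge_2] in eventually_elim)
         (simp only: nn_integral_ratio_integrand[OF \<theta>] E_eq c_def mult_ac)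
    also have "\<dots> = ennreal c * (\<integral>\<^sup>+x. indicator R x * (\<integral>\<^sup>+q. ennreal (ratio_integrand \<theta> x q) \<partial>\<mu>) \<partial>P 0)"
      by (simp add: sample_law_eq_density nn_integral_density nn_integral_cmult)
    finally show ?thesis .
  qed
  \<comment> \<open>Normalization: the whole space under the null hypothesis determines \<open>\<kappa>\<close>.\<close>
  have sp: "invariant_region n (space (lborel_n n))"
    using sets.top[of "lborel_n n"]
    by (auto simp: invariant_region_def space_PiM cong: sets_PiM_cong)
  have "\<kappa> * emeasure (P 0) (space (lborel_n n)) =
      ennreal c * (\<integral>\<^sup>+x. indicator (space (lborel_n n)) x * ennreal total_weight \<partial>P 0)"
    by (subst main[OF order_refl sp]) (simp add: ratio_integrand_0 emeasure_\<mu>)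
  then have "\<kappa> = ennreal c * ennreal total_weight"
    using P0.emeasure_space_1 sets.top[of "lborel_n n"]
    by (simp add: space_P nn_integral_multc)
  with main[OF \<theta> R] have "ennreal c * (ennreal total_weight * emeasure (P \<theta>) R) =
    ennreal c * (\<integral>\<^sup>+x. indicator R x * (\<integral>\<^sup>+q. ennreal (ratio_integrand \<theta> x q) \<partial>\<mu>) \<partial>P 0)"
    by (simp add: mult.assoc)
  then show ?thesis using c by (simp add: ennreal_mult_cancel_left)
qed


section \<open>The slope of the power at the normal distribution\<close>

lemma f_has_derivative:
  assumes \<theta>: "\<theta> \<ge> 0"
  shows "((\<lambda>t. f y t) has_real_derivative f_theta f y \<theta>) (at \<theta> within {0..})"
proof -
  have "((\<lambda>t. ln (f y t)) has_real_derivative l_theta f y \<theta>) (at \<theta> within {0..})"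
    using log_differentiable[OF \<theta>, of y]
    by (simp add: l_theta_def vector_derivative_works has_real_derivative_iff_has_vector_derivative)
  then have "((\<lambda>t. exp (ln (f y t))) has_real_derivative exp (ln (f y \<theta>)) * l_theta f y \<theta>) (at \<theta> within {0..})"
    by (rule DERIV_chain2[OF DERIV_exp])
  then have "((\<lambda>t. f y t) has_real_derivative exp (ln (f y \<theta>)) * l_theta f y \<theta>) (at \<theta> within {0..})"
    by (rule has_field_derivative_transform_within[where d=1]) (use \<theta> density_pos in auto)
  then have "(\<lambda>t. f y t) differentiable (at \<theta> within {0..})"
    using differentiableI_vector has_real_derivative_iff_has_vector_derivative by blast
  then show ?thesis
    by (simp add: f_theta_def vector_derivative_works has_real_derivative_iff_has_vector_derivative)
qed

lemma ln_f_has_derivative_0: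
  "((\<lambda>t. ln (f y t)) has_real_derivative l_theta f y 0) (at 0 within {0..})"
  using log_differentiable[OF order_refl, of y]
  by (simp add: l_theta_def vector_derivative_works has_real_derivative_iff_has_vector_derivative)

lemma abs_ratio_minus_one_le:
  assumes g: "\<And>t. 0 \<le> t \<Longrightarrow> t \<le> \<epsilon> \<Longrightarrow> \<bar>f_theta f y t\<bar> / f y 0 \<le> g" and \<theta>: "0 \<le> \<theta>" "\<theta> \<le> \<epsilon>"
  shows "\<bar>f y \<theta> / f y 0 - 1\<bar> \<le> \<theta> * g"
proof -
  have f0: "f y 0 > 0" by (rule density_pos) simp
  have "norm (f y \<theta> - f y 0) \<le> (g * f y 0) * norm (\<theta> - 0)"
  proof (rule field_differentiable_bound[where S="{0..\<theta>}" and f'="\<lambda>t. f_theta f y t"])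
    fix t assume t: "t \<in> {0..\<theta>}"
    then show "((\<lambda>t. f y t) has_field_derivative f_theta f y t) (at t within {0..\<theta>})"
      using f_has_derivative[of t y] by (auto intro: has_field_derivative_subset)
    show "norm (f_theta f y t) \<le> g * f y 0"
      using g[of t] t \<theta> f0 by (simp add: divide_le_eq)
  qed (use \<theta> in auto)
  then have "\<bar>f y \<theta> - f y 0\<bar> / f y 0 \<le> \<theta> * g"
    using f0 \<theta> by (simp add: divide_le_eq mult_ac)
  moreover have "f y \<theta> / f y 0 - 1 = (f y \<theta> - f y 0) / f y 0"
    using f0 by (simp add: field_simps)
  ultimately show ?thesis using f0 by simp
qed

text \<open>
  An envelope for the relative derivatives, where the supremum runs over the open interval of all
  \<open>y = a + b z\<close> with \<open>\<bar>z\<bar> < sqrt n\<close>. Its superlevel sets are unions of open cones in the \<open>(b, a)\<close> plane,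
  so it is Borel. It is below the supremum over the closed interval, and it still covers all
  standardized observations, because they satisfy the strict inequality.
\<close>

definition envelope :: "real \<times> real \<Rightarrow> ennreal" where
  "envelope q = (SUP (y, t) \<in> {y. \<bar>y - snd q\<bar> < fst q * sqrt (real n)} \<times> {0..\<epsilon>}.
     ennreal (\<bar>f_theta f y t\<bar> / f y 0))"

lemma measurable_envelope [measurable]: "envelope \<in> borel_measurable (lborel \<Otimes>\<^sub>M lborel)"
proof -
  have "envelope \<in> borel_measurable borel"
  proof (rule borel_measurableI_greater)
    fix c :: ennreal
    have "{q \<in> space borel. c < envelope q} =
        (\<Union>(y, t)\<in>{(y, t). t \<in> {0..\<epsilon>} \<and> c < ennreal (\<bar>f_theta f y t\<bar> / f y 0)}.
           {q. \<bar>y - snd q\<bar> < fst q * sqrt (real n)})"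
      unfolding envelope_def less_SUP_iff by (auto; force)
    also have "open \<dots>"
      by (intro open_UN ballI) (auto intro!: open_Collect_less continuous_intros)
    finally show "{q \<in> space borel. c < envelope q} \<in> sets borel" by simp
  qed
  then show ?thesis by (simp add: lborel_prod)
qed

lemma envelope_le_g_bound:
  assumes "b > 0" shows "envelope (b, a) \<le> g_bound f n a b \<epsilon>"
  unfolding envelope_def
proof (intro SUP_least, clarsimp)
  fix y t assume y: "\<bar>y - a\<bar> < b * sqrt (real n)" and t: "0 \<le> t" "t \<le> \<epsilon>"
  define z where "z = (y - a) / b"
  have "\<bar>z\<bar> \<le> sqrt (real n)" using y assms by (simp add: z_def divide_le_eq mult.commute)
  then have "(z, t) \<in> {- sqrt (real n)..sqrt (real n)} \<times> {0..\<epsilon>}" using t by auto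
  moreover have "a + b * z = y" using assms by (simp add: z_def)
  ultimately show "ennreal (\<bar>f_theta f y t\<bar> / f y 0) \<le> g_bound f n a b \<epsilon>"
    unfolding g_bound_def by (intro SUP_upper2[of "(z, t)"]) auto
qed

lemma nn_integral_envelope: "(\<integral>\<^sup>+q. envelope q ^ n \<partial>\<mu>) < \<infinity>"
proof -
  have "(\<integral>\<^sup>+q. envelope q ^ n \<partial>\<mu>) =
      (\<integral>\<^sup>+b. (\<integral>\<^sup>+a. ennreal (orbit_weight n (b, a)) * envelope (b, a) ^ n \<partial>lborel) \<partial>lborel)"
    by (subst nn_integral_orbit_measure, simp, subst lborel.nn_integral_fst[symmetric]) auto
  also have "\<dots> \<le> (\<integral>\<^sup>+ b \<in> {0<..}. (\<integral>\<^sup>+ a. g_bound f n a b \<epsilon> ^ n *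
          ennreal (exp (- (real n * (a\<^sup>2 + b\<^sup>2) / 2)) * b ^ (n - 2)) \<partial>lborel) \<partial>lborel)"
  proof (rule nn_integral_mono)
    fix b :: real
    show "(\<integral>\<^sup>+a. ennreal (orbit_weight n (b, a)) * envelope (b, a) ^ n \<partial>lborel) \<le>
      (\<integral>\<^sup>+ a. g_bound f n a b \<epsilon> ^ n * ennreal (exp (- (real n * (a\<^sup>2 + b\<^sup>2) / 2)) * b ^ (n - 2)) \<partial>lborel) *
      indicator {0<..} b"
    proof (cases "b > 0")
      case True
      then show ?thesis
        by (simp add: orbit_weight_def mult.commute)
           (intro nn_integral_mono mult_right_mono power_mono envelope_le_g_bound; simp)
    qed (simp add: orbit_weight_def)
  qed
  also have "\<dots> < \<infinity>" by (rule integrability)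
  finally show ?thesis .
qed

lemma AE_envelope_finite: "AE q in \<mu>. envelope q < \<infinity>"
proof -
  have "AE q in \<mu>. envelope q ^ n \<noteq> \<infinity>"
    using nn_integral_envelope by (intro nn_integral_PInf_AE) auto
  then show ?thesis
    by eventually_elim (use n_pos in \<open>auto simp: less_top power_eq_top_ennreal\<close>)
qed

definition dominating :: "real \<times> real \<Rightarrow> real" where
  "dominating q = (1 + \<epsilon> * enn2real (envelope q)) ^ n / \<epsilon>"

lemma integrable_dominating: "integrable \<mu> dominating"
proof -
  let ?G = "\<lambda>q. enn2real (envelope q)"
  have "integrable \<mu> (\<lambda>q. ?G q ^ n)"
  proof (rule integrableI_bounded)
    have "(\<integral>\<^sup>+q. ennreal (norm (?G q ^ n)) \<partial>\<mu>) \<le> (\<integral>\<^sup>+q. envelope q ^ n \<partial>\<mu>)"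
      by (intro nn_integral_mono)
         (auto simp: ennreal_power[symmetric] enn2real_nonneg ennreal_enn2real_if power_eq_top_ennreal
               intro!: power_mono)
    also note nn_integral_envelope
    finally show "(\<integral>\<^sup>+q. ennreal (norm (?G q ^ n)) \<partial>\<mu>) < \<infinity>" .
  qed measurable
  then have "integrable \<mu> (\<lambda>q. 2 ^ n * (1 + \<epsilon> ^ n * ?G q ^ n) / \<epsilon>)"
    by (intro integrable_divide integrable_mult_right Bochner_Integration.integrable_add \<mu>.integrable_const) auto
  then show ?thesis
  proof (rule Bochner_Integration.integrable_bound)
    show "dominating \<in> borel_measurable \<mu>" unfolding dominating_def by measurable
    show "AE q in \<mu>. norm (dominating q) \<le> norm (2 ^ n * (1 + \<epsilon> ^ n * ?G q ^ n) / \<epsilon>)"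
    proof (rule AE_I2)
      fix q
      have u: "\<epsilon> * ?G q \<ge> 0" using eps_pos by (simp add: enn2real_nonneg)
      have "(1 + \<epsilon> * ?G q) ^ n \<le> 2 ^ n * (1 + \<epsilon> ^ n * ?G q ^ n)"
        using power_one_plus_le[OF u, of n] by (simp add: power_mult_distrib)
      moreover have "(1 + \<epsilon> * ?G q) ^ n \<ge> 0" using u by simp
      ultimately show "norm (dominating q) \<le> norm (2 ^ n * (1 + \<epsilon> ^ n * ?G q ^ n) / \<epsilon>)"
        using eps_pos by (simp add: dominating_def divide_right_mono abs_mult)
    qed
  qed
qed

definition difference_quotient :: "real \<Rightarrow> (nat \<Rightarrow> real) \<Rightarrow> real \<times> real \<Rightarrow> real" where
  "difference_quotient \<theta> x q = (ratio_integrand \<theta> x q - 1) / \<theta>"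

text \<open>
  By the mean value theorem each factor of the likelihood ratio differs from 1 by at most \<open>\<theta>\<close> times the
  envelope. Expanding the product and comparing with its chord gives a bound by the \<open>n\<close>-th power of the
  envelope, which is integrable, and it depends neither on \<open>\<theta>\<close> nor on the sample.
\<close>

lemma abs_difference_quotient_le:
  assumes \<theta>: "0 < \<theta>" "\<theta> \<le> \<epsilon>" and q: "fst q > 0" "envelope q < \<infinity>" and s: "sample_sd n x > 0"
  shows "\<bar>difference_quotient \<theta> x q\<bar> \<le> dominating q"
proof -
  define G where "G = enn2real (envelope q)"
  have G: "ennreal G = envelope q" "G \<ge> 0" using q by (simp_all add: G_def enn2real_nonneg)
  have r: "\<bar>f (snd q + fst q * standardized n x i) \<theta> / f (snd q + fst q * standardized n x i) 0 - 1\<bar> \<le> \<theta> * G"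
    if i: "i < n" for i
  proof (rule abs_ratio_minus_one_le)
    let ?y = "snd q + fst q * standardized n x i"
    fix t assume t: "0 \<le> t" "t \<le> \<epsilon>"
    have "\<bar>?y - snd q\<bar> < fst q * sqrt (real n)"
      using abs_standardized_less[OF n_pos s i] q by (simp add: abs_mult)
    then have "ennreal (\<bar>f_theta f ?y t\<bar> / f ?y 0) \<le> ennreal G"
      unfolding G envelope_def using t by (intro SUP_upper2[of "(?y, t)"]) auto
    then show "\<bar>f_theta f ?y t\<bar> / f ?y 0 \<le> G" by (simp only: ennreal_le_iff[OF G(2)])
  qed (use \<theta> in auto)
  have "\<bar>ratio_integrand \<theta> x q - 1\<bar> \<le> (1 + \<theta> * G) ^ n - 1"
    unfolding ratio_integrand_def using \<theta> G(2) r
    by (intro abs_prod_minus_one_le) auto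
  also have "(1 + \<theta> * G) ^ n = (1 + \<theta> / \<epsilon> * (\<epsilon> * G)) ^ n" using eps_pos by simp
  also have "\<dots> - 1 \<le> \<theta> / \<epsilon> * ((1 + \<epsilon> * G) ^ n - 1)"
    using power_one_plus_chord_le[of "\<theta> / \<epsilon>" "\<epsilon> * G" n] \<theta> eps_pos G(2) by simp
  also have "\<dots> \<le> \<theta> * dominating q"
    using \<theta> eps_pos by (simp add: dominating_def G_def divide_right_mono mult_left_mono)
  finally show ?thesis using \<theta> by (simp add: difference_quotient_def divide_le_eq mult.commute)
qed

text \<open>
  The likelihood ratio is the exponential of a sum of differences of logarithms that vanish at
  \<open>\<theta> = 0\<close>, so its derivative there is the sum of the score functions.
\<close>

lemma difference_quotient_tendsto:
  assumes S: "\<And>k. S k > 0" "S \<longlonglongrightarrow> 0"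
  shows "(\<lambda>k. difference_quotient (S k) x q) \<longlonglongrightarrow> score_integrand x q"
proof -
  let ?y = "\<lambda>i. snd q + fst q * standardized n x i"
  have e: "ratio_integrand t x q = exp (\<Sum>i<n. ln (f (?y i) t) - ln (f (?y i) 0))" if t: "t \<ge> 0" for t
    using density_pos[OF t] density_pos[of 0]
    by (simp add: ratio_integrand_def exp_sum exp_diff)
  have "((\<lambda>t. exp (\<Sum>i<n. ln (f (?y i) t) - ln (f (?y i) 0))) has_real_derivative
      exp (\<Sum>i<n. ln (f (?y i) 0) - ln (f (?y i) 0)) * (\<Sum>i<n. l_theta f (?y i) 0 - 0)) (at 0 within {0..})"
    by (intro DERIV_chain2[OF DERIV_exp] DERIV_sum DERIV_diff DERIV_const ln_f_has_derivative_0)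
  then have "((\<lambda>t. exp (\<Sum>i<n. ln (f (?y i) t) - ln (f (?y i) 0))) has_real_derivative
      score_integrand x q) (at 0 within {0..})"
    by (simp add: score_integrand_def)
  then have "((\<lambda>t. ratio_integrand t x q) has_real_derivative score_integrand x q) (at 0 within {0..})"
    by (rule has_field_derivative_transform_within[where d=1]) (auto simp: e)
  then have "((\<lambda>t. (ratio_integrand t x q - ratio_integrand 0 x q) / (t - 0)) \<longlongrightarrow> score_integrand x q)
      (at 0 within {0..})"
    by (simp add: has_field_derivative_iff)
  then have lim: "((\<lambda>t. difference_quotient t x q) \<longlongrightarrow> score_integrand x q) (at 0 within {0..})"
    by (simp add: ratio_integrand_0 difference_quotient_def)
  have "filterlim S (at 0 within {0..}) sequentially"
  proof -
    have "S k \<in> {0..} \<and> S k \<noteq> 0" for k using S(1)[of k] by simp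
    then show ?thesis using S(2) by (simp add: filterlim_at)
  qed
  from filterlim_compose[OF lim this] show ?thesis .
qed

lemma measurable_difference_quotient [measurable]:
  assumes "\<theta> \<ge> 0"
  shows "difference_quotient \<theta> x \<in> borel_measurable (lborel \<Otimes>\<^sub>M lborel)"
proof -
  note measurable_ratio_integrand[OF assms, measurable]
  show ?thesis unfolding difference_quotient_def by measurable
qed

lemma measurable_difference_quotient_pair [measurable]:
  assumes "\<theta> \<ge> 0"
  shows "(\<lambda>(x, q). difference_quotient \<theta> x q) \<in> borel_measurable (lborel_n n \<Otimes>\<^sub>M (lborel \<Otimes>\<^sub>M lborel))"
proof -
  note measurable_ratio_integrand_pair[OF assms, measurable]
  show ?thesis unfolding difference_quotient_def by measurable
qed

lemma score_integrand_LIMSEQ: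
  "(\<lambda>k. difference_quotient (1 / Suc k) x q) \<longlonglongrightarrow> score_integrand x q"
  by (rule difference_quotient_tendsto[OF _ LIMSEQ_Suc[OF lim_const_over_n]]) simp

lemma measurable_score_integrand [measurable]:
  "score_integrand x \<in> borel_measurable (lborel \<Otimes>\<^sub>M lborel)"
  by (rule borel_measurable_LIMSEQ_real[OF score_integrand_LIMSEQ]) simp

lemma measurable_score_integrand_pair [measurable]:
  "(\<lambda>(x, q). score_integrand x q) \<in> borel_measurable (lborel_n n \<Otimes>\<^sub>M (lborel \<Otimes>\<^sub>M lborel))"
  by (rule borel_measurable_LIMSEQ_real[where u="\<lambda>k (x, q). difference_quotient (1 / Suc k) x q"])
     (auto simp: score_integrand_LIMSEQ simp del: of_nat_Suc)

lemma AE_dominated: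
  assumes \<theta>: "0 < \<theta>" "\<theta> \<le> \<epsilon>" and s: "sample_sd n x > 0"
  shows "AE q in \<mu>. norm (difference_quotient \<theta> x q) \<le> dominating q"
  using AE_orbit_measure_pos AE_envelope_finite
  by eventually_elim (use abs_difference_quotient_le[OF \<theta> _ _ s] in auto)

definition mean_quotient :: "real \<Rightarrow> (nat \<Rightarrow> real) \<Rightarrow> real" where
  "mean_quotient \<theta> x = (\<integral>q. difference_quotient \<theta> x q \<partial>\<mu>)"

definition mean_score :: "(nat \<Rightarrow> real) \<Rightarrow> real" where
  "mean_score x = (\<integral>q. score_integrand x q \<partial>\<mu>)"

lemma integrable_difference_quotient:
  assumes \<theta>: "0 < \<theta>" "\<theta> \<le> \<epsilon>" and s: "sample_sd n x > 0"
  shows "integrable \<mu> (difference_quotient \<theta> x)"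
  by (rule Bochner_Integration.integrable_bound[OF integrable_dominating])
     (use \<theta> AE_dominated[OF assms] in \<open>auto elim: AE_mp\<close>)

lemma
  assumes S: "\<And>k. S k > 0" "\<And>k. S k \<le> \<epsilon>" "S \<longlonglongrightarrow> 0" and s: "sample_sd n x > 0"
  shows mean_quotient_tendsto: "(\<lambda>k. mean_quotient (S k) x) \<longlonglongrightarrow> mean_score x"
    and integrable_score_integrand_aux: "integrable \<mu> (score_integrand x)"
proof -
  have [measurable]: "difference_quotient (S k) x \<in> borel_measurable (lborel \<Otimes>\<^sub>M lborel)" for k
    using S(1)[of k] by simp
  have m: "score_integrand x \<in> borel_measurable \<mu>" "\<And>k. difference_quotient (S k) x \<in> borel_measurable \<mu>"
    by measurable
  have lim: "AE q in \<mu>. (\<lambda>k. difference_quotient (S k) x q) \<longlonglongrightarrow> score_integrand x q"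
    by (intro AE_I2 difference_quotient_tendsto S)
  show "(\<lambda>k. mean_quotient (S k) x) \<longlonglongrightarrow> mean_score x"
    unfolding mean_quotient_def mean_score_def
    by (rule integral_dominated_convergence[OF m integrable_dominating lim]) (intro AE_dominated S s)
  show "integrable \<mu> (score_integrand x)"
    by (rule integrable_dominated_convergence[OF m integrable_dominating lim]) (intro AE_dominated S s)
qed

lemma integrable_score_integrand:
  assumes "sample_sd n x > 0"
  shows "integrable \<mu> (score_integrand x)"
proof (rule integrable_score_integrand_aux[where S="\<lambda>k. \<epsilon> / Suc k"])
  show "(\<lambda>k. \<epsilon> / Suc k) \<longlonglongrightarrow> 0"
    by (rule LIMSEQ_Suc[OF lim_const_over_n])
qed (use eps_pos assms in \<open>auto simp: divide_le_eq\<close>)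

definition quotient_bound :: real where
  "quotient_bound = (\<integral>q. dominating q \<partial>\<mu>)"

lemma abs_mean_quotient_le:
  assumes \<theta>: "0 < \<theta>" "\<theta> \<le> \<epsilon>" and s: "sample_sd n x > 0"
  shows "\<bar>mean_quotient \<theta> x\<bar> \<le> quotient_bound"
proof -
  have "\<bar>mean_quotient \<theta> x\<bar> \<le> (\<integral>q. \<bar>difference_quotient \<theta> x q\<bar> \<partial>\<mu>)"
    unfolding mean_quotient_def by (rule integral_abs_bound)
  also have "\<dots> \<le> quotient_bound"
    unfolding quotient_bound_def using AE_dominated[OF assms]
    by (intro integral_mono_AE integrable_abs integrable_difference_quotient[OF assms] integrable_dominating)
       auto
  finally show ?thesis .
qed

lemma measurable_mean_quotient [measurable]:
  assumes "\<theta> \<ge> 0"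
  shows "mean_quotient \<theta> \<in> borel_measurable (lborel_n n)"
proof -
  have [measurable]: "(\<lambda>(x, q). difference_quotient \<theta> x q) \<in> borel_measurable (lborel_n n \<Otimes>\<^sub>M \<mu>)"
    using measurable_difference_quotient_pair[OF assms]
    by (subst measurable_cong_sets[OF sets_pair_measure_cong[OF refl sets_orbit_measure] refl])
  show ?thesis unfolding mean_quotient_def[abs_def]
    by (rule \<mu>.borel_measurable_lebesgue_integral) measurable
qed

lemma measurable_mean_score [measurable]: "mean_score \<in> borel_measurable (lborel_n n)"
proof -
  have [measurable]: "(\<lambda>(x, q). score_integrand x q) \<in> borel_measurable (lborel_n n \<Otimes>\<^sub>M \<mu>)"
    using measurable_score_integrand_pair
    by (subst measurable_cong_sets[OF sets_pair_measure_cong[OF refl sets_orbit_measure] refl])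
  show ?thesis unfolding mean_score_def[abs_def]
    by (rule \<mu>.borel_measurable_lebesgue_integral) measurable
qed

lemma nn_integral_ratio_eq_mean_quotient:
  assumes \<theta>: "0 < \<theta>" "\<theta> \<le> \<epsilon>" and s: "sample_sd n x > 0"
  shows "(\<integral>\<^sup>+q. ennreal (ratio_integrand \<theta> x q) \<partial>\<mu>) = ennreal (total_weight + \<theta> * mean_quotient \<theta> x)"
    and "total_weight + \<theta> * mean_quotient \<theta> x \<ge> 0"
proof -
  have e: "ratio_integrand \<theta> x = (\<lambda>q. 1 + \<theta> * difference_quotient \<theta> x q)"
    using \<theta> by (simp add: fun_eq_iff difference_quotient_def)
  note i = integrable_difference_quotient[OF assms]
  have int: "integrable \<mu> (ratio_integrand \<theta> x)"
    unfolding e by (intro Bochner_Integration.integrable_add integrable_mult_right i) simp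
  have val: "(\<integral>q. ratio_integrand \<theta> x q \<partial>\<mu>) = total_weight + \<theta> * mean_quotient \<theta> x"
    unfolding e using i by (simp add: total_weight_def mean_quotient_def)
  have nonneg: "AE q in \<mu>. 0 \<le> ratio_integrand \<theta> x q"
    using \<theta> ratio_integrand_pos[of \<theta> x] by (intro AE_I2) (simp add: less_imp_le)
  show "(\<integral>\<^sup>+q. ennreal (ratio_integrand \<theta> x q) \<partial>\<mu>) = ennreal (total_weight + \<theta> * mean_quotient \<theta> x)"
    using nn_integral_eq_integral[OF int nonneg] val by simp
  show "total_weight + \<theta> * mean_quotient \<theta> x \<ge> 0"
    unfolding val[symmetric] by (rule integral_nonneg_AE[OF nonneg])
qed

lemma integrable_mean_quotient:
  assumes \<theta>: "0 < \<theta>" "\<theta> \<le> \<epsilon>"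
  shows "integrable (P 0) (mean_quotient \<theta>)"
proof (rule P0.integrable_const_bound[where B=quotient_bound])
  show "AE x in P 0. norm (mean_quotient \<theta> x) \<le> quotient_bound"
    using AE_P0_sample_sd_pos by eventually_elim (use abs_mean_quotient_le[OF assms] in auto)
  show "mean_quotient \<theta> \<in> borel_measurable (P 0)" using \<theta> by simp
qed

text \<open>
  The likelihood ratio is 1 plus \<open>\<theta>\<close> times its difference quotient, and the 1 contributes the
  rejection probability under the null hypothesis.
\<close>

lemma rejection_prob_quotient:
  assumes \<theta>: "0 < \<theta>" "\<theta> \<le> \<epsilon>" and R: "invariant_region n R"
  shows "(rejection_prob f n \<theta> R - rejection_prob f n 0 R) / \<theta> =
    (\<integral>x. indicator R x * mean_quotient \<theta> x \<partial>P 0) / total_weight"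
proof -
  note invariant_region_measurable[OF R, measurable]
  interpret P\<theta>: prob_space "P \<theta>" using \<theta> by (intro prob_space_P) simp
  have m[measurable]: "mean_quotient \<theta> \<in> borel_measurable (lborel_n n)" using \<theta> by simp
  have i1: "integrable (P 0) (\<lambda>x. indicator R x * mean_quotient \<theta> x)"
    by (rule Bochner_Integration.integrable_bound[OF integrable_mean_quotient[OF \<theta>]])
       (auto simp: indicator_def)
  have i2: "integrable (P 0) (\<lambda>x. indicator R x * total_weight)"
    by (intro integrable_mult_left) (simp add: integrable_indicator_iff P0.emeasure_finite less_top[symmetric])
  have e: "(\<lambda>x. indicator R x * (total_weight + \<theta> * mean_quotient \<theta> x)) =
     (\<lambda>x. indicator R x * total_weight + \<theta> * (indicator R x * mean_quotient \<theta> x))"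
    by (simp add: fun_eq_iff algebra_simps)
  have i3: "integrable (P 0) (\<lambda>x. indicator R x * (total_weight + \<theta> * mean_quotient \<theta> x))"
    unfolding e by (intro Bochner_Integration.integrable_add i2 integrable_mult_right i1)
  have nonneg: "AE x in P 0. 0 \<le> indicator R x * (total_weight + \<theta> * mean_quotient \<theta> x)"
    using AE_P0_sample_sd_pos
    by eventually_elim (auto simp: indicator_def nn_integral_ratio_eq_mean_quotient(2)[OF \<theta>])
  have "ennreal (total_weight * rejection_prob f n \<theta> R) = ennreal total_weight * emeasure (P \<theta>) R"
    using total_weight_pos by (simp add: rejection_prob_def P\<theta>.emeasure_eq_measure ennreal_mult)
  also have "\<dots> = (\<integral>\<^sup>+x. indicator R x * (\<integral>\<^sup>+q. ennreal (ratio_integrand \<theta> x q) \<partial>\<mu>) \<partial>P 0)"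
    using \<theta> by (intro emeasure_P_eq_ratio_integral R) simp
  also have "\<dots> = (\<integral>\<^sup>+x. ennreal (indicator R x * (total_weight + \<theta> * mean_quotient \<theta> x)) \<partial>P 0)"
    by (intro nn_integral_cong_AE, use AE_P0_sample_sd_pos in eventually_elim)
       (auto simp: indicator_def nn_integral_ratio_eq_mean_quotient(1)[OF \<theta>])
  also have "\<dots> = ennreal (\<integral>x. indicator R x * (total_weight + \<theta> * mean_quotient \<theta> x) \<partial>P 0)"
    by (rule nn_integral_eq_integral[OF i3 nonneg])
  finally have "total_weight * rejection_prob f n \<theta> R =
      (\<integral>x. indicator R x * (total_weight + \<theta> * mean_quotient \<theta> x) \<partial>P 0)"
    using total_weight_pos integral_nonneg_AE[OF nonneg] by (subst (asm) ennreal_inj) (auto simp: rejection_prob_def)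
  also have "\<dots> = rejection_prob f n 0 R * total_weight +
      \<theta> * (\<integral>x. indicator R x * mean_quotient \<theta> x \<partial>P 0)"
    unfolding e using i1 i2 by (simp add: rejection_prob_def)
  finally show ?thesis
    using \<theta> total_weight_pos by (simp add: field_simps)
qed

definition slope :: "(nat \<Rightarrow> real) set \<Rightarrow> real" where
  "slope R = (\<integral>x. indicator R x * mean_score x \<partial>P 0) / total_weight"

text \<open>
  Dominated convergence is used twice: along the orbits it gave the pointwise limit of the mean
  quotients, and here it passes to the limit in the integral over samples, with a constant as bound.
\<close>

lemma rejection_prob_derivative:
  assumes R: "invariant_region n R"
  shows "((\<lambda>\<theta>. (rejection_prob f n \<theta> R - rejection_prob f n 0 R) / \<theta>) \<longlongrightarrow>
     slope R) (at_right 0)"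
  unfolding slope_def
proof (rule tendsto_at_right_sequentially[OF eps_pos])
  fix S assume S: "\<And>k. 0 < S k" "\<And>k. S k < \<epsilon>" "S \<longlonglongrightarrow> (0 :: real)"
  note invariant_region_measurable[OF R, measurable]
  have [measurable]: "mean_quotient (S k) \<in> borel_measurable (lborel_n n)" for k
    using S(1)[of k] by simp
  have "(\<lambda>k. \<integral>x. indicator R x * mean_quotient (S k) x \<partial>P 0) \<longlonglongrightarrow> (\<integral>x. indicator R x * mean_score x \<partial>P 0)"
  proof (rule integral_dominated_convergence[where w="\<lambda>_. quotient_bound"])
    show "AE x in P 0. (\<lambda>k. indicator R x * mean_quotient (S k) x) \<longlonglongrightarrow> indicator R x * mean_score x"
      using AE_P0_sample_sd_pos
      by eventually_elim (intro tendsto_mult_left mean_quotient_tendsto S less_imp_le)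
    show "AE x in P 0. norm (indicator R x * mean_quotient (S k) x) \<le> quotient_bound" for k
      using AE_P0_sample_sd_pos
    proof eventually_elim
      fix x assume "sample_sd n x > 0"
      then have "\<bar>mean_quotient (S k) x\<bar> \<le> quotient_bound"
        by (intro abs_mean_quotient_le S less_imp_le)
      then show "norm (indicator R x * mean_quotient (S k) x) \<le> quotient_bound"
        by (auto simp: indicator_def)
    qed
  qed measurable
  then have "(\<lambda>k. (\<integral>x. indicator R x * mean_quotient (S k) x \<partial>P 0) / total_weight) \<longlonglongrightarrow>
      (\<integral>x. indicator R x * mean_score x \<partial>P 0) / total_weight"
    using total_weight_pos by (intro tendsto_divide tendsto_const) auto
  then show "(\<lambda>k. (rejection_prob f n (S k) R - rejection_prob f n 0 R) / S k) \<longlonglongrightarrow>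
      (\<integral>x. indicator R x * mean_score x \<partial>P 0) / total_weight"
    using S by (simp add: rejection_prob_quotient[OF _ _ R] less_imp_le)
qed

lemma integrable_mean_score: "integrable (P 0) mean_score"
proof (rule P0.integrable_const_bound[where B=quotient_bound])
  show "AE x in P 0. norm (mean_score x) \<le> quotient_bound"
    using AE_P0_sample_sd_pos
  proof eventually_elim
    fix x assume s: "sample_sd n x > 0"
    have S: "(\<lambda>k. \<epsilon> / Suc k) \<longlonglongrightarrow> 0"
      by (rule LIMSEQ_Suc[OF lim_const_over_n])
    have S': "0 < \<epsilon> / Suc k" "\<epsilon> / Suc k \<le> \<epsilon>" for k
      using eps_pos by (auto simp: divide_le_eq)
    have "(\<lambda>k. norm (mean_quotient (\<epsilon> / Suc k) x)) \<longlonglongrightarrow> norm (mean_score x)"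
      by (intro tendsto_norm mean_quotient_tendsto S S' s)
    then show "norm (mean_score x) \<le> quotient_bound"
      by (rule LIMSEQ_le_const2)
         (intro exI allI impI, simp only: real_norm_def, rule abs_mean_quotient_le[OF S' s])
  qed
qed simp

lemma T_stat_standardized:
  "T_stat f n (standardized n x) =
     (\<integral>b. (\<integral>a. orbit_weight n (b, a) * score_integrand x (b, a) \<partial>lborel) \<partial>lborel)"
  unfolding T_stat_def set_lebesgue_integral_def
  by (intro Bochner_Integration.integral_cong refl)
     (auto simp: orbit_weight_def score_integrand_def indicator_def mult_ac)

lemma measurable_T_stat [measurable]:
  "(\<lambda>x. T_stat f n (standardized n x)) \<in> borel_measurable (lborel_n n)"
proof -
  have m: "(\<lambda>z. score_integrand (fst (fst z)) (snd (fst z), snd z)) \<in>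
      borel_measurable ((lborel_n n \<Otimes>\<^sub>M lborel) \<Otimes>\<^sub>M lborel)"
    using measurable_compose[OF _ measurable_score_integrand_pair,
       of "\<lambda>z. (fst (fst z), (snd (fst z), snd z))" "(lborel_n n \<Otimes>\<^sub>M lborel) \<Otimes>\<^sub>M lborel"] by simp
  show ?thesis
    unfolding T_stat_standardized
    using m by (intro lborel.borel_measurable_lebesgue_integral) (simp add: case_prod_beta')
qed

text \<open>
  Integrability with respect to the product measure identifies the iterated integral that defines the
  test statistic with the integral over the orbit measure.
\<close>

lemma T_stat_eq_mean_score:
  assumes "sample_sd n x > 0"
  shows "T_stat f n (standardized n x) = mean_score x"
proof -
  have "integrable (lborel \<Otimes>\<^sub>M lborel) (\<lambda>q. orbit_weight n q * score_integrand x q)"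
    using integrable_score_integrand[OF assms] unfolding orbit_measure_def
    by (subst (asm) integrable_density) (auto simp: orbit_weight_nonneg)
  then have "T_stat f n (standardized n x) = (\<integral>q. orbit_weight n q * score_integrand x q \<partial>(lborel \<Otimes>\<^sub>M lborel))"
    unfolding T_stat_standardized by (rule lborel_pair.integral_fst')
  also have "\<dots> = mean_score x"
    unfolding mean_score_def orbit_measure_def
    by (subst integral_density) (auto simp: orbit_weight_nonneg)
  finally show ?thesis .
qed

lemma T_stat_affine:
  assumes "b > 0"
  shows "T_stat f n (standardized n (\<lambda>i\<in>{..<n}. a + b * x i)) = T_stat f n (standardized n x)"
proof -
  have "(\<Sum>i<n. l_theta f (c + d * standardized n (\<lambda>i\<in>{..<n}. a + b * x i) i) 0) =
        (\<Sum>i<n. l_theta f (c + d * standardized n x i) 0)" for c d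
    using standardized_affine[OF n_pos assms] by (intro sum.cong) auto
  then show ?thesis by (simp add: T_stat_def)
qed

lemma invariant_region_T_stat:
  "invariant_region n {x \<in> {..<n} \<rightarrow>\<^sub>E UNIV. T_stat f n (standardized n x) > k}"
proof -
  have "{x \<in> {..<n} \<rightarrow>\<^sub>E UNIV. T_stat f n (standardized n x) > k} =
      {x \<in> space (lborel_n n). T_stat f n (standardized n x) > k}" by (simp add: space_PiM)
  also have "\<dots> \<in> sets (lborel_n n)" by measurable
  finally show ?thesis
    unfolding invariant_region_def by (auto simp: T_stat_affine cong: sets_PiM_cong)
qed


section \<open>The Neyman-Pearson argument for slopes\<close>

lemma rejection_prob_tendsto:
  assumes "invariant_region n R"
  shows "((\<lambda>\<theta>. rejection_prob f n \<theta> R) \<longlongrightarrow> rejection_prob f n 0 R) (at_right 0)"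
proof -
  have "((\<lambda>\<theta>. rejection_prob f n 0 R + \<theta> * ((rejection_prob f n \<theta> R - rejection_prob f n 0 R) / \<theta>))
      \<longlongrightarrow> rejection_prob f n 0 R + 0 * slope R) (at_right 0)"
    by (intro tendsto_add tendsto_mult tendsto_const tendsto_ident_at rejection_prob_derivative assms)
  moreover have "eventually (\<lambda>\<theta>. rejection_prob f n 0 R +
      \<theta> * ((rejection_prob f n \<theta> R - rejection_prob f n 0 R) / \<theta>) = rejection_prob f n \<theta> R) (at_right 0)"
    using eventually_at_right_less[of 0] by eventually_elim simp
  ultimately show ?thesis by (simp add: tendsto_cong)
qed

lemma rejection_prob_eq_if_AE_eq:
  assumes \<theta>: "\<theta> \<ge> 0" and R: "invariant_region n R" "invariant_region n R'"
    and eq: "AE x in lborel_n n. x \<in> R \<longleftrightarrow> x \<in> R'"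
  shows "rejection_prob f n \<theta> R = rejection_prob f n \<theta> R'"
  unfolding rejection_prob_def using eq R[THEN invariant_region_measurable]
  by (intro measure_eq_AE) (auto simp: AE_P_iff[OF \<theta>])

text \<open>
  The Neyman-Pearson lemma with \<open>T\<close> in the place of the likelihood ratio. Since the sizes agree, the
  threshold \<open>k\<close> may be subtracted from \<open>T\<close>, and the difference of slopes becomes the integral of
  \<open>(1_R - 1_R') (T - k)\<close>, which is nonnegative. It vanishes only if the regions differ inside the null
  set \<open>T = k\<close>.
\<close>

lemma slope_le_region:
  fixes k :: real
  defines "R \<equiv> {x \<in> {..<n} \<rightarrow>\<^sub>E UNIV. T_stat f n (standardized n x) > k}"
  assumes R': "invariant_region n R'" and size: "rejection_prob f n 0 R' = rejection_prob f n 0 R"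
    and null: "rejection_prob f n 0 {x \<in> {..<n} \<rightarrow>\<^sub>E UNIV. T_stat f n (standardized n x) = k} = 0"
  shows slope_le: "slope R' \<le> slope R"
    and slope_eq_imp_AE_eq: "slope R' = slope R \<Longrightarrow> AE x in lborel_n n. x \<in> R \<longleftrightarrow> x \<in> R'"
proof -
  have R: "invariant_region n R" unfolding R_def by (rule invariant_region_T_stat)
  note [measurable] = R[THEN invariant_region_measurable] R'[THEN invariant_region_measurable]
  have int: "integrable (P 0) (\<lambda>x. indicator A x * mean_score x)"
    if "A \<in> sets (lborel_n n)" for A
    using that by (intro Bochner_Integration.integrable_bound[OF integrable_mean_score])
      (auto simp: indicator_def)
  have ind: "integrable (P 0) (\<lambda>x. indicator A x * k)" if "A \<in> sets (lborel_n n)" for A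
    using that by (intro integrable_mult_left) (simp add: P0.emeasure_finite less_top[symmetric])
  define h where "h x = (indicator R x - indicator R' x) * (mean_score x - k)" for x
  have h: "h = (\<lambda>x. (indicator R x * mean_score x - indicator R' x * mean_score x) -
      (indicator R x * k - indicator R' x * k))"
    by (simp add: h_def fun_eq_iff algebra_simps)
  have int_h: "integrable (P 0) h"
    unfolding h by (intro Bochner_Integration.integrable_diff int ind) auto
  have "(\<integral>x. h x \<partial>P 0) = (\<integral>x. indicator R x * mean_score x \<partial>P 0) - (\<integral>x. indicator R' x * mean_score x \<partial>P 0)
      - (rejection_prob f n 0 R * k - rejection_prob f n 0 R' * k)"
    unfolding h using int ind by (simp add: rejection_prob_def)
  then have gap: "(\<integral>x. h x \<partial>P 0) = total_weight * (slope R - slope R')"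
    using total_weight_pos size by (simp add: slope_def algebra_simps)
  have iff: "AE x in P 0. sample_sd n x > 0 \<and> (x \<in> R \<longleftrightarrow> mean_score x > k) \<and> (x \<in> R' \<longrightarrow> x \<in> space (P 0))"
    using AE_P0_sample_sd_pos AE_space
    by eventually_elim (auto simp: R_def T_stat_eq_mean_score space_P space_PiM)
  have nonneg: "AE x in P 0. 0 \<le> h x"
    using iff by eventually_elim (auto simp: h_def indicator_def)
  show "slope R' \<le> slope R"
    using integral_nonneg_AE[OF nonneg] gap total_weight_pos by (simp add: zero_le_mult_iff)
  assume "slope R' = slope R"
  then have "(\<integral>x. h x \<partial>P 0) = 0" using gap by simp
  then have h0: "AE x in P 0. h x = 0"
    using integral_nonneg_eq_0_iff_AE[OF int_h nonneg] by simp
  let ?B = "{x \<in> {..<n} \<rightarrow>\<^sub>E UNIV. T_stat f n (standardized n x) = k}"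
  have "?B = {x \<in> space (lborel_n n). T_stat f n (standardized n x) = k}" by (simp add: space_PiM)
  also have "\<dots> \<in> sets (lborel_n n)" by measurable
  finally have "?B \<in> null_sets (P 0)"
    using null by (simp add: null_sets_def P0.emeasure_eq_measure rejection_prob_def)
  then have "AE x in P 0. x \<notin> ?B" by (rule AE_not_in)
  with h0 iff AE_space have "AE x in P 0. x \<in> R \<longleftrightarrow> x \<in> R'"
  proof eventually_elim
    case (elim x)
    then have "mean_score x \<noteq> k"
      by (auto simp: T_stat_eq_mean_score space_P space_PiM)
    with elim(1) show ?case by (auto simp: h_def indicator_def split: if_splits)
  qed
  then show "AE x in lborel_n n. x \<in> R \<longleftrightarrow> x \<in> R'" by (simp add: AE_P_iff)
qed

text \<open>
  A competitor of smaller size has smaller power near 0 by continuity, whichever of the two slopes is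
  the larger. A competitor of the same size and smaller slope loses in first order, and one
  with the same slope is almost everywhere the same region.
\<close>

lemma rejection_prob_eventually_le:
  fixes k :: real
  defines "R \<equiv> {x \<in> {..<n} \<rightarrow>\<^sub>E UNIV. T_stat f n (standardized n x) > k}"
  assumes R': "invariant_region n R'" and size: "rejection_prob f n 0 R' \<le> rejection_prob f n 0 R"
    and null: "rejection_prob f n 0 {x \<in> {..<n} \<rightarrow>\<^sub>E UNIV. T_stat f n (standardized n x) = k} = 0"
  shows "eventually (\<lambda>\<theta>. rejection_prob f n \<theta> R' \<le> rejection_prob f n \<theta> R) (at_right 0)"
proof -
  have R: "invariant_region n R" unfolding R_def by (rule invariant_region_T_stat)
  show ?thesis
  proof (cases "rejection_prob f n 0 R' < rejection_prob f n 0 R")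
    case True
    have "((\<lambda>\<theta>. rejection_prob f n \<theta> R - rejection_prob f n \<theta> R') \<longlongrightarrow>
        rejection_prob f n 0 R - rejection_prob f n 0 R') (at_right 0)"
      by (intro tendsto_diff rejection_prob_tendsto R R')
    then have "eventually (\<lambda>\<theta>. 0 < rejection_prob f n \<theta> R - rejection_prob f n \<theta> R') (at_right 0)"
      by (rule order_tendstoD) (use True in simp)
    then show ?thesis by eventually_elim simp
  next
    case False
    then have size': "rejection_prob f n 0 R' = rejection_prob f n 0 R" using size by simp
    note np = slope_le_region[OF R' size'[unfolded R_def] null, folded R_def]
    show ?thesis
    proof (cases "slope R' = slope R")
      case True
      show ?thesis
        using eventually_at_right_less[of 0]
        by eventually_elim (use rejection_prob_eq_if_AE_eq[OF _ R R' np(2)[OF True]] in auto)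
    next
      case False
      have "((\<lambda>\<theta>. (rejection_prob f n \<theta> R - rejection_prob f n 0 R) / \<theta> -
          (rejection_prob f n \<theta> R' - rejection_prob f n 0 R') / \<theta>) \<longlongrightarrow> slope R - slope R') (at_right 0)"
        by (intro tendsto_diff rejection_prob_derivative R R')
      then have "eventually (\<lambda>\<theta>. 0 < (rejection_prob f n \<theta> R - rejection_prob f n 0 R) / \<theta> -
          (rejection_prob f n \<theta> R' - rejection_prob f n 0 R') / \<theta>) (at_right 0)"
        by (rule order_tendstoD) (use False np(1) in simp)
      then show ?thesis
        using eventually_at_right_less[of 0]
        by eventually_elim (simp add: size' zero_less_divide_iff flip: diff_divide_distrib)
    qed
  qed
qed

lemma LBI_region_iff:
  "LBI_region f n R \<longleftrightarrow> invariant_region n R \<and>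
     (\<forall>R'. invariant_region n R' \<longrightarrow> rejection_prob f n 0 R' \<le> rejection_prob f n 0 R \<longrightarrow>
        eventually (\<lambda>\<theta>. rejection_prob f n \<theta> R' \<le> rejection_prob f n \<theta> R) (at_right 0))"
  unfolding LBI_region_def eventually_at_right_field by (intro conj_cong refl) metis

lemma LBI_region_T_stat:
  assumes "rejection_prob f n 0 {x \<in> {..<n} \<rightarrow>\<^sub>E UNIV. T_stat f n (standardized n x) = k} = 0"
  shows "LBI_region f n {x \<in> {..<n} \<rightarrow>\<^sub>E UNIV. T_stat f n (standardized n x) > k}"
  unfolding LBI_region_iff
  using invariant_region_T_stat rejection_prob_eventually_le[OF _ _ assms] by blast

text \<open>
  Two locally best regions of the same size have the same slope, because each has eventually at least
  the power of the other; equality in the Neyman-Pearson lemma then makes them agree almost everywhere.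
\<close>

lemma LBI_region_unique:
  fixes k :: real
  defines "R \<equiv> {x \<in> {..<n} \<rightarrow>\<^sub>E UNIV. T_stat f n (standardized n x) > k}"
  assumes LBI: "LBI_region f n R'" and size: "rejection_prob f n 0 R' = rejection_prob f n 0 R"
    and null: "rejection_prob f n 0 {x \<in> {..<n} \<rightarrow>\<^sub>E UNIV. T_stat f n (standardized n x) = k} = 0"
  shows "(R - R') \<union> (R' - R) \<in> null_sets (lborel_n n)"
proof -
  have R: "invariant_region n R" unfolding R_def by (rule invariant_region_T_stat)
  have R': "invariant_region n R'" using LBI by (simp add: LBI_region_iff)
  note [measurable] = R[THEN invariant_region_measurable] R'[THEN invariant_region_measurable]
  have "eventually (\<lambda>\<theta>. rejection_prob f n \<theta> R \<le> rejection_prob f n \<theta> R') (at_right 0)"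
    using LBI R size by (simp add: LBI_region_iff)
  then have "eventually (\<lambda>\<theta>. (rejection_prob f n \<theta> R - rejection_prob f n 0 R) / \<theta> \<le>
      (rejection_prob f n \<theta> R' - rejection_prob f n 0 R') / \<theta>) (at_right 0)"
    using eventually_at_right_less[of 0]
    by eventually_elim (simp add: size divide_right_mono)
  then have "slope R \<le> slope R'"
    by (intro tendsto_le[OF _ rejection_prob_derivative[OF R'] rejection_prob_derivative[OF R]]) simp_all
  note np = slope_le_region[OF R' size[unfolded R_def] null, folded R_def]
  have "AE x in lborel_n n. x \<in> R \<longleftrightarrow> x \<in> R'"
    using np \<open>slope R \<le> slope R'\<close> by (simp add: order_antisym)
  then have "AE x in lborel_n n. x \<notin> (R - R') \<union> (R' - R)" by eventually_elim auto
  then show ?thesis by (subst (asm) AE_iff_null_sets[symmetric]) auto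
qed

end

theorem theorem1:
  fixes f :: "real \<Rightarrow> real \<Rightarrow> real" and n :: nat and \<epsilon> k :: real
  assumes "n \<ge> 3"
    and density_measurable: "\<And>\<theta>. \<theta> \<ge> 0 \<Longrightarrow> (\<lambda>x. f x \<theta>) \<in> borel_measurable borel"
    and density_integral: "\<And>\<theta>. \<theta> \<ge> 0 \<Longrightarrow> (\<integral>\<^sup>+ x. ennreal (f x \<theta>) \<partial>lborel) = 1"
    and density_pos: "\<And>x \<theta>. \<theta> \<ge> 0 \<Longrightarrow> f x \<theta> > 0"
    and normal: "\<And>x. f x 0 = 1 / sqrt (2 * pi) * exp (- (x\<^sup>2 / 2))"
    and log_differentiable:
      "\<And>x \<theta>. \<theta> \<ge> 0 \<Longrightarrow> (\<lambda>t. ln (f x t)) differentiable (at \<theta> within {0..})"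
    and log_deriv_continuous: "\<And>x. continuous_on {0..} (\<lambda>\<theta>. l_theta f x \<theta>)"
    and "\<epsilon> > 0"
    and integrability:
      "(\<integral>\<^sup>+ b \<in> {0<..}. (\<integral>\<^sup>+ a. g_bound f n a b \<epsilon> ^ n *
          ennreal (exp (- (real n * (a\<^sup>2 + b\<^sup>2) / 2)) * b ^ (n - 2)) \<partial>lborel) \<partial>lborel) < \<infinity>"
    and null_boundary:
      "rejection_prob f n 0 {x \<in> {..<n} \<rightarrow>\<^sub>E UNIV. T_stat f n (standardized n x) = k} = 0"
  defines "R \<equiv> {x \<in> {..<n} \<rightarrow>\<^sub>E UNIV. T_stat f n (standardized n x) > k}"
  shows "LBI_region f n R \<and>
    (\<forall>R'. LBI_region f n R' \<and> rejection_prob f n 0 R' = rejection_prob f n 0 R \<longrightarrow>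
       (R - R') \<union> (R' - R) \<in> null_sets (\<Pi>\<^sub>M i\<in>{..<n}. (lborel :: real measure)))"
proof -
  interpret normal_alternative f n \<epsilon>
    by unfold_locales fact+
  show ?thesis
    unfolding R_def using LBI_region_T_stat[OF null_boundary] LBI_region_unique[OF _ _ null_boundary]
    by blast
qed

end
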